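(* Let $\sigma:\mathbb{R}\to\mathbb{R}$ be analytic with $\sigma\ge c_0$ on $\mathbb{R}$ for some constant $c_0>0$, and let $\mu,\gamma>0$. Let $\overline\alpha\in\mathbb{R}$ satisfy $\sigma'(\overline\alpha)=0$ (so $(0,\overline\alpha)$ is an equilibrium), and let $0<\theta\le\frac12$, $C_{LS}>0$ be constants such that, on some neighborhood $U$ of $(0,\overline\alpha)$ in $Y$, $$\|\dot E(v,\beta)\|_Y\ge C_{LS}\,|E[v,\beta]-E[0,\overline\alpha]|^{1-\theta}\qquad\text{for all }(v,\beta)\in U$$ (the Łojasiewicz–Simon inequality). Then there is a neighborhood $V$ of $(0,\overline\alpha)$ in $Y$ with the following property. Let $u_0:\mathbb{T}\to\mathbb{R}$ with $u_0\in H^2_{\mathrm{per.ave}}(0,1)$, let $\alpha_0\in\mathbb{R}$, and let $(u,\alpha)$ be a time-global classical solution of $$\begin{cases}\dfrac{u_t}{\sqrt{1+u_x^2}}=\mu\,\sigma(\alpha(t))\left(\dfrac{u_x}{\sqrt{1+u_x^2}}\right)_x, & x\in\mathbb{T},\ t>0,\\[2mm] \alpha_t(t)=-\gamma\,\sigma'(\alpha(t))\displaystyle\int_0^1\sqrt{1+u_x^2(x,t)}\,dx, & t>0,\\ u(x,0)=u_0(x),\ x\in\mathbb{T},\qquad \alpha(0)=\alpha_0,\end{cases}$$ such that $(u(\cdot,t),\alpha(t))\in V$ for all $t>0$. Then there is a constant $C>0$ depending only on $\mu,\gamma,\alpha_0,\|u_0\|_{H^2_{\mathrm{per.ave}}(0,1)},\theta,C_{LS}$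 (for the fixed function $\sigma$) such that for all $0<t<s<\infty$, $$|\alpha(t)-\alpha(s)|\le C\,\bigl|E[u,\alpha](t)-E[0,\overline\alpha]\bigr|^{\theta},\qquad \|u(t)-u(s)\|_{L^2(0,1)}\le C\,\bigl|E[u,\alpha](t)-E[0,\overline\alpha]\bigr|^{\theta}.$$
   Context: $\mathbb{T}=\mathbb{R}/\mathbb{Z}$. Let $H^k_{\mathrm{per.ave}}(0,1)=\{u\in H^k(0,1): u_x\in H^{k-1}(\mathbb{T}),\ \int_0^1u\,dx=0\}$ for $k=1,2$ (with $H^0=L^2$), with $\|u\|^2_{H^1_{\mathrm{per.ave}}(0,1)}=\int_0^1u_x^2\,dx$ and $\|u\|^2_{H^2_{\mathrm{per.ave}}(0,1)}=\int_0^1u_x^2\,dx+\int_0^1u_{xx}^2\,dx$. $Y=H^2_{\mathrm{per.ave}}(0,1)\times\mathbb{R}$ with $\|(u,\alpha)\|_Y^2=\|u\|_{H^2_{\mathrm{per.ave}}(0,1)}^2+\alpha^2$. Energy: $E[u,\alpha]=\sigma(\alpha)\int_0^1\sqrt{1+u_x^2}\,dx$, and $E[u,\alpha](t)=E[u(\cdot,t),\alpha(t)]$. Its derivative (gradient with respect to the inner product $\int_0^1u_xv_x\,dx+\alpha\beta$ on $H^1_{\mathrm{per.ave}}(0,1)\times\mathbb{R}$) is $$\dot{E}(u,\alpha)=\left(\sigma(\alpha)\left\{\int_{0}^{x}\frac{u_{x}}{\sqrt{1+u_{x}^{2}}}\,dy-\int_{0}^{1}\int_{0}^{x}\frac{u_{x}}{\sqrt{1+u_{x}^{2}}}\,dy\,dx\right\},\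 \sigma'(\alpha)\int_{0}^{1}\sqrt{1+u_{x}^{2}}\,dx\right).$$ A time-global classical solution is a pair $u:\mathbb{T}\times[0,\infty)\to\mathbb{R}$, $\alpha:[0,\infty)\to\mathbb{R}$, continuous up to $t=0$ with $u_t,u_x,u_{xx}$ continuous on $\mathbb{T}\times(0,\infty)$ and $\alpha\in C^1((0,\infty))$, satisfying the equations pointwise and attaining the initial data. *)

theory Defs
  imports "HOL-Analysis.Analysis"
begin

definition real_analytic :: "(real \<Rightarrow> real) \<Rightarrow> bool" where
  "real_analytic f \<longleftrightarrow> (\<forall>x. \<exists>F. (\<lambda>h. f (x + h)) has_fps_expansion F)"


section \<open>Sobolev spaces on the unit interval\<close>

text \<open>
  Elements of the function spaces are represented by total functions on the reals; only their
  values almost everywhere on the open unit interval matter.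
\<close>

abbreviation unit_integral :: "(real \<Rightarrow> real) \<Rightarrow> real" where
  "unit_integral f \<equiv> (LINT x:{0<..<1}|lebesgue. f x)"

definition L2 :: "(real \<Rightarrow> real) set" where
  "L2 = {f. set_borel_measurable lebesgue {0<..<1} f
          \<and> set_integrable lebesgue {0<..<1} (\<lambda>x. (f x)\<^sup>2)}"

definition norm_L2 :: "(real \<Rightarrow> real) \<Rightarrow> real" where
  "norm_L2 f = sqrt (unit_integral (\<lambda>x. (f x)\<^sup>2))"

text \<open>
  As in Brezis' textbook, the test functions are continuously differentiable; by mollification
  this gives the same weak derivatives as smooth test functions.
\<close>

definition test_functions :: "(real \<Rightarrow> real) set" where
  "test_functions = {\<phi>. \<phi> C1_differentiable_on UNIV \<and> closure {x. \<phi> x \<noteq> 0} \<subseteq> {0<..<1}}"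

definition torus_test_functions :: "(real \<Rightarrow> real) set" where
  "torus_test_functions = {\<phi>. \<phi> C1_differentiable_on UNIV \<and> (\<forall>x. \<phi> (x + 1) = \<phi> x)}"

definition weak_deriv :: "(real \<Rightarrow> real) \<Rightarrow> (real \<Rightarrow> real) \<Rightarrow> bool" where
  "weak_deriv u g \<longleftrightarrow> u \<in> L2 \<and> g \<in> L2 \<and>
     (\<forall>\<phi>\<in>test_functions.
        unit_integral (\<lambda>x. u x * deriv \<phi> x) = - unit_integral (\<lambda>x. g x * \<phi> x))"

text \<open>
  On the torus the test functions need not vanish at the end points, so that a weak derivative
  in the following sense exists only if the continuous representative of \<open>u\<close> is periodic.
\<close>

definition torus_weak_deriv :: "(real \<Rightarrow> real) \<Rightarrow> (real \<Rightarrow> real) \<Rightarrow> bool" where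
  "torus_weak_deriv u g \<longleftrightarrow> u \<in> L2 \<and> g \<in> L2 \<and>
     (\<forall>\<phi>\<in>torus_test_functions.
        unit_integral (\<lambda>x. u x * deriv \<phi> x) = - unit_integral (\<lambda>x. g x * \<phi> x))"

primrec sobolev :: "nat \<Rightarrow> (real \<Rightarrow> real) set" where
  "sobolev 0 = L2"
| "sobolev (Suc k) = {u. \<exists>g\<in>sobolev k. weak_deriv u g}"

primrec torus_sobolev :: "nat \<Rightarrow> (real \<Rightarrow> real) set" where
  "torus_sobolev 0 = L2"
| "torus_sobolev (Suc k) = {u. \<exists>g\<in>torus_sobolev k. torus_weak_deriv u g}"

text \<open>
  Weak derivatives are unique up to null sets; \<open>wderiv\<close> only ever occurs under an integral.
\<close>

definition wderiv :: "(real \<Rightarrow> real) \<Rightarrow> real \<Rightarrow> real" where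
  "wderiv u = (SOME g. weak_deriv u g)"

text \<open>Periodicity is imposed on the derivative only, not on the function itself.\<close>

definition H_per_ave :: "nat \<Rightarrow> (real \<Rightarrow> real) set" where
  "H_per_ave k = {u \<in> sobolev k. wderiv u \<in> torus_sobolev (k - 1) \<and> unit_integral u = 0}"

definition norm_H2 :: "(real \<Rightarrow> real) \<Rightarrow> real" where
  "norm_H2 u = sqrt (unit_integral (\<lambda>x. (wderiv u x)\<^sup>2)
                   + unit_integral (\<lambda>x. (wderiv (wderiv u) x)\<^sup>2))"

definition Y :: "((real \<Rightarrow> real) \<times> real) set" where
  "Y = H_per_ave 2 \<times> UNIV"

definition norm_Y :: "(real \<Rightarrow> real) \<times> real \<Rightarrow> real" where
  "norm_Y = (\<lambda>(u, \<alpha>). sqrt ((norm_H2 u)\<^sup>2 + \<alpha>\<^sup>2))"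

definition nbhd_Y :: "(real \<Rightarrow> real) \<times> real \<Rightarrow> ((real \<Rightarrow> real) \<times> real) set \<Rightarrow> bool" where
  "nbhd_Y = (\<lambda>(u, \<alpha>) U. U \<subseteq> Y \<and>
     (\<exists>\<epsilon>>0. \<forall>(v, \<beta>)\<in>Y. norm_Y (\<lambda>x. v x - u x, \<beta> - \<alpha>) < \<epsilon> \<longrightarrow> (v, \<beta>) \<in> U))"


section \<open>Energy and its gradient\<close>

definition energy :: "(real \<Rightarrow> real) \<Rightarrow> (real \<Rightarrow> real) \<times> real \<Rightarrow> real" where
  "energy \<sigma> = (\<lambda>(u, \<alpha>). \<sigma> \<alpha> * unit_integral (\<lambda>x. sqrt (1 + (wderiv u x)\<^sup>2)))"

definition energy_gradient ::
    "(real \<Rightarrow> real) \<Rightarrow> (real \<Rightarrow> real) \<times> real \<Rightarrow> (real \<Rightarrow> real) \<times> real" where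
  "energy_gradient \<sigma> = (\<lambda>(u, \<alpha>).
     let G = (\<lambda>x. LINT y:{0<..<x}|lebesgue. wderiv u y / sqrt (1 + (wderiv u y)\<^sup>2))
     in (\<lambda>x. \<sigma> \<alpha> * (G x - unit_integral G),
         deriv \<sigma> \<alpha> * unit_integral (\<lambda>x. sqrt (1 + (wderiv u x)\<^sup>2))))"


section \<open>Classical solutions\<close>

text \<open>The space-time function \<open>u x t\<close> takes the space variable first.\<close>

definition dt :: "(real \<Rightarrow> real \<Rightarrow> real) \<Rightarrow> real \<Rightarrow> real \<Rightarrow> real" where
  "dt u x t = deriv (\<lambda>\<tau>. u x \<tau>) t"

definition dx :: "(real \<Rightarrow> real \<Rightarrow> real) \<Rightarrow> real \<Rightarrow> real \<Rightarrow> real" where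
  "dx u x t = deriv (\<lambda>y. u y t) x"

definition global_classical_solution ::
    "(real \<Rightarrow> real) \<Rightarrow> real \<Rightarrow> real \<Rightarrow> (real \<Rightarrow> real) \<Rightarrow> real
      \<Rightarrow> (real \<Rightarrow> real \<Rightarrow> real) \<Rightarrow> (real \<Rightarrow> real) \<Rightarrow> bool" where
  "global_classical_solution \<sigma> \<mu> \<gamma> u0 \<alpha>0 u \<alpha> \<longleftrightarrow>
     (\<forall>x. \<forall>t\<ge>0. u (x + 1) t = u x t) \<and>
     continuous_on (UNIV \<times> {0..}) (\<lambda>(x, t). u x t) \<and>
     continuous_on {0..} \<alpha> \<and>
     (\<forall>x. \<forall>t>0. (\<lambda>\<tau>. u x \<tau>) differentiable (at t) \<and>
               (\<lambda>y. u y t) differentiable (at x) \<and>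
               (\<lambda>y. dx u y t) differentiable (at x)) \<and>
     continuous_on (UNIV \<times> {0<..}) (\<lambda>(x, t). dt u x t) \<and>
     continuous_on (UNIV \<times> {0<..}) (\<lambda>(x, t). dx u x t) \<and>
     continuous_on (UNIV \<times> {0<..}) (\<lambda>(x, t). dx (dx u) x t) \<and>
     \<alpha> C1_differentiable_on {0<..} \<and>
     (\<forall>x. \<forall>t>0. dt u x t / sqrt (1 + (dx u x t)\<^sup>2)
               = \<mu> * \<sigma> (\<alpha> t) * deriv (\<lambda>y. dx u y t / sqrt (1 + (dx u y t)\<^sup>2)) x) \<and>
     (\<forall>t>0. deriv \<alpha> t
               = - \<gamma> * deriv \<sigma> (\<alpha> t) * unit_integral (\<lambda>x. sqrt (1 + (dx u x t)\<^sup>2))) \<and>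
     (\<forall>x. u x 0 = u0 x) \<and> \<alpha> 0 = \<alpha>0"

end

theory Submission
  imports Defs
begin

text \<open>
  Write \<open>H = E[u,\<alpha>] - E[0,\<alpha>bar]\<close> along the flow and let \<open>\<kappa>\<close> be the \<open>x\<close>-derivative of
  \<open>u_x / sqrt (1 + u_x\<^sup>2)\<close>. Then \<open>H' = - D\<close>, where \<open>D\<close> is \<open>\<gamma> (\<sigma>'(\<alpha>) L)\<^sup>2\<close>, \<open>L\<close> the length of the
  graph, plus \<open>\<mu> \<sigma>(\<alpha>)\<^sup>2\<close> times the integral of \<open>sqrt (1 + u_x\<^sup>2) \<kappa>\<^sup>2\<close>. Since \<open>u\<close> is periodic, \<open>u_x\<close>
  vanishes somewhere, so the first derivative of the gradient component is bounded by the \<open>L\<^sup>2\<close> norm of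
  its second derivative \<open>\<sigma>(\<alpha>) \<kappa>\<close>; hence \<open>D\<close> dominates \<open>min \<gamma> (\<mu>/2)\<close> times the squared norm of the
  energy gradient, and the Lojasiewicz-Simon inequality gives \<open>sqrt D \<ge> c \<bar>H\<bar> powr (1 - \<theta>)\<close>. If \<open>H\<close> were
  ever negative, the energy would tend to minus infinity; so \<open>H \<ge> 0\<close> and \<open>- (H powr \<theta>)' \<ge> c \<theta> sqrt D\<close>.
  In the unit ball of \<open>Y\<close> one has \<open>\<bar>u_x\<bar> \<le> 1\<close>, and then \<open>\<bar>\<alpha>_t\<bar>\<close> and the \<open>L\<^sup>2\<close> norm of \<open>u_t\<close> are at most
  \<open>sqrt (\<gamma> + 2 \<mu>) sqrt D\<close>. Integrating in time, for \<open>u\<close> after pairing with \<open>u(t) - u(s)\<close>, gives both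
  estimates.
\<close>

section \<open>Weak derivatives of continuously differentiable functions\<close>

lemma DERIV_pos_part_square:
  "((\<lambda>x::real. (max 0 x)\<^sup>2) has_real_derivative 2 * max 0 x) (at x)"
proof (cases "x = 0")
  case True
  \<comment> \<open>At the kink the difference quotient is at most \<open>\<bar>h\<bar>\<close>;
    squaring is what makes the positive part continuously differentiable, hence fit for building
    test functions.\<close>
  have "((\<lambda>x::real. (max 0 x)\<^sup>2) has_real_derivative 0) (at 0)"
    unfolding DERIV_def
  proof (simp, rule Lim_null_comparison)
    show "\<forall>\<^sub>F h in at 0. norm ((max 0 h)\<^sup>2 / h) \<le> \<bar>h::real\<bar>"
      by (rule eventuallyI) (auto simp: max_def power2_eq_square)
    show "((\<lambda>h. \<bar>h::real\<bar>) \<longlongrightarrow> 0) (at 0)"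
      by (rule tendsto_eq_intros refl | simp)+
  qed
  then show ?thesis by (simp add: True)
next
  case False
  then consider "x > 0" | "x < 0" by linarith
  then show ?thesis
  proof cases
    case 1
    have "((\<lambda>x::real. x\<^sup>2) has_real_derivative 2 * x) (at x)"
      by (auto intro!: derivative_eq_intros)
    then have "((\<lambda>x::real. (max 0 x)\<^sup>2) has_real_derivative 2 * x) (at x)"
      by (rule has_field_derivative_transform_within_open[where S="{0<..}"]) (use 1 in auto)
    then show ?thesis using 1 by (simp add: max_def)
  next
    case 2
    have "((\<lambda>x::real. (max 0 x)\<^sup>2) has_real_derivative 0) (at x)"
      by (rule has_field_derivative_transform_within_open[OF DERIV_const[of 0], where S="{..<0}"]) (use 2 in \<open>auto simp: max_def\<close>)
    then show ?thesis using 2 by (simp add: max_def)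
  qed
qed

text \<open>As \<open>n\<close> grows, these test functions increase to the indicator function of \<open>{a<..<b}\<close>.\<close>

lemma bump_test_function:
  assumes "0 < a" "b < 1"
  defines "p \<equiv> \<lambda>x::real. (max 0 (x - a))\<^sup>2 * (max 0 (b - x))\<^sup>2"
  shows "(\<lambda>x. real n * p x / (1 + real n * p x)) \<in> test_functions"
proof -
  define p' where "p' = (\<lambda>x::real. 2 * max 0 (x - a) * (max 0 (b - x))\<^sup>2 - (max 0 (x - a))\<^sup>2 * (2 * max 0 (b - x)))"
  have 1: "((\<lambda>x. (max 0 (x - a))\<^sup>2) has_real_derivative 2 * max 0 (x - a)) (at x)" for x
  proof -
    have "((\<lambda>x. x - a) has_real_derivative 1) (at x)" by (auto intro!: derivative_eq_intros)
    from DERIV_chain2[OF DERIV_pos_part_square this] show ?thesis by simp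
  qed
  have 2: "((\<lambda>x. (max 0 (b - x))\<^sup>2) has_real_derivative - (2 * max 0 (b - x))) (at x)" for x
  proof -
    have "((\<lambda>x. b - x) has_real_derivative -1) (at x)" by (auto intro!: derivative_eq_intros)
    from DERIV_chain2[OF DERIV_pos_part_square this] show ?thesis by simp
  qed
  have dp: "(p has_real_derivative p' x) (at x)" for x
    unfolding p_def p'_def by (rule derivative_eq_intros 1 2 refl | simp)+
  have p0: "p x \<ge> 0" for x by (simp add: p_def)
  have pos: "1 + real n * p x > 0" for x using p0[of x] by (simp add: add_pos_nonneg)
  define D where "D = (\<lambda>x. real n * p' x / (1 + real n * p x)\<^sup>2)"
  have d: "((\<lambda>x. real n * p x / (1 + real n * p x)) has_real_derivative D x) (at x)" for x
    unfolding D_def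
    by (rule derivative_eq_intros dp refl | use pos[of x] in \<open>simp add: power2_eq_square field_simps\<close>)+
  have contp: "continuous_on UNIV p" unfolding p_def by (intro continuous_intros)
  have "continuous_on UNIV D"
    unfolding D_def p'_def by (intro continuous_intros contp) (use pos in \<open>auto simp: less_le\<close>)
  then have "(\<lambda>x. real n * p x / (1 + real n * p x)) C1_differentiable_on UNIV"
    unfolding C1_differentiable_on_def using d has_real_derivative_iff_has_vector_derivative by blast
  \<comment> \<open>The bump vanishes outside \<open>{a..b}\<close>, a closed set inside
    \<open>{0<..<1}\<close> because \<open>0 < a\<close> and \<open>b < 1\<close>.\<close>
  moreover have "closure {x. real n * p x / (1 + real n * p x) \<noteq> 0} \<subseteq> {a..b}"
    by (rule closure_minimal) (auto simp: p_def max_def split: if_splits)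
  ultimately show ?thesis using assms by (force simp: test_functions_def)
qed

text \<open>The positive and negative parts of \<open>h\<close> are densities of two measures that
  agree and are finite on all rays, hence agree on all Borel sets; densities of equal measures
  coincide almost everywhere.\<close>

lemma AE_eq_0_of_greaterThan_integrals:
  fixes h :: "real \<Rightarrow> real"
  assumes int: "integrable lebesgue h"
    and zero: "\<And>a. (LINT x:{a<..}|lebesgue. h x) = 0"
  shows "AE x in lebesgue. h x = 0"
proof -
  \<comment> \<open>A Borel representative moves the argument from the completed measure to
    \<open>lborel\<close>, where measures are determined by their values on rays.\<close>
  obtain g where g [measurable]: "g \<in> borel_measurable lborel" and gh: "AE x in lborel. h x = g x"
    using completion_ex_borel_measurable_real[OF borel_measurable_integrable[OF int]] by auto
  have gm [measurable]: "g \<in> borel_measurable lebesgue"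
    using g by (rule measurable_completion)
  have [measurable]: "h \<in> borel_measurable lebesgue" using int by auto
  have gh': "AE x in lebesgue. h x = g x" using gh by (rule AE_completion)
  have "integrable lebesgue g"
    using integrable_cong_AE[OF _ gm gh'] int by auto
  then have ig: "integrable lborel g" using integrable_completion[OF g] by simp
  have z: "(\<integral>x. indicator {a<..} x * g x \<partial>lborel) = 0" for a :: real
  proof -
    have "(\<integral>x. indicator {a<..} x * g x \<partial>lborel) = (\<integral>x. indicator {a<..} x * g x \<partial>lebesgue)"
      by (rule integral_completion[symmetric]) simp
    also have "\<dots> = (\<integral>x. indicator {a<..} x *\<^sub>R h x \<partial>lebesgue)"
    proof (rule integral_cong_AE)
      have [measurable]: "{a<..} \<in> sets lebesgue" by simp
      show "(\<lambda>x. indicator {a<..} x * g x) \<in> borel_measurable lebesgue" by measurable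
      show "(\<lambda>x. indicator {a<..} x *\<^sub>R h x) \<in> borel_measurable lebesgue" by measurable
    qed (use gh' in auto)
    finally show ?thesis using zero[of a] by (simp add: set_lebesgue_integral_def)
  qed
  \<comment> \<open>\<open>ennreal\<close> sends negative numbers to \<open>0\<close>, so these
    densities are the positive and the negative part of \<open>g\<close>.\<close>
  let ?P = "density lborel (\<lambda>x. ennreal (g x))" and ?N = "density lborel (\<lambda>x. ennreal (- g x))"
  have P: "emeasure ?P {a<..} = ennreal (\<integral>x. indicator {a<..} x * max 0 (g x) \<partial>lborel)" for a :: real
  proof -
    have i: "integrable lborel (\<lambda>x. indicator {a<..} x * max 0 (g x))"
      by (rule Bochner_Integration.integrable_bound[OF ig]) (auto simp: indicator_def)
    have "emeasure ?P {a<..} = (\<integral>\<^sup>+x. ennreal (indicator {a<..} x * max 0 (g x)) \<partial>lborel)"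
      by (subst emeasure_density) (auto intro!: nn_integral_cong simp: indicator_def max_def ennreal_neg)
    also have "\<dots> = ennreal (\<integral>x. indicator {a<..} x * max 0 (g x) \<partial>lborel)"
      by (rule nn_integral_eq_integral[OF i]) (auto simp: indicator_def)
    finally show ?thesis .
  qed
  have N: "emeasure ?N {a<..} = ennreal (\<integral>x. indicator {a<..} x * max 0 (- g x) \<partial>lborel)" for a :: real
  proof -
    have i: "integrable lborel (\<lambda>x. indicator {a<..} x * max 0 (- g x))"
      by (rule Bochner_Integration.integrable_bound[OF ig]) (auto simp: indicator_def)
    have "emeasure ?N {a<..} = (\<integral>\<^sup>+x. ennreal (indicator {a<..} x * max 0 (- g x)) \<partial>lborel)"
      by (subst emeasure_density) (auto intro!: nn_integral_cong simp: indicator_def max_def ennreal_neg)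
    also have "\<dots> = ennreal (\<integral>x. indicator {a<..} x * max 0 (- g x) \<partial>lborel)"
      by (rule nn_integral_eq_integral[OF i]) (auto simp: indicator_def)
    finally show ?thesis .
  qed
  have PN: "emeasure ?P {a<..} = emeasure ?N {a<..}" for a :: real
  proof -
    have i: "integrable lborel (\<lambda>x. indicator {a<..} x * max 0 (g x))"
        "integrable lborel (\<lambda>x. indicator {a<..} x * max 0 (- g x))"
      by (rule Bochner_Integration.integrable_bound[OF ig], auto simp: indicator_def)+
    have "(\<integral>x. indicator {a<..} x * max 0 (g x) - indicator {a<..} x * max 0 (- g x) \<partial>lborel)
        = (\<integral>x. indicator {a<..} x * g x \<partial>lborel)"
      by (rule Bochner_Integration.integral_cong) (auto simp: indicator_def max_def)
    then have "(\<integral>x. indicator {a<..} x * max 0 (g x) - indicator {a<..} x * max 0 (- g x) \<partial>lborel) = 0"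
      using z[of a] by simp
    then show ?thesis unfolding P N Bochner_Integration.integral_diff[OF i] by simp
  qed
  have "?P = ?N"
    by (rule measure_eqI_lessThan) (auto simp: PN, auto simp: N)
  moreover have "(\<integral>\<^sup>+x. ennreal (g x) \<partial>lborel) \<noteq> \<infinity>"
    using ig by (simp add: integrable_iff_bounded)
      (metis (mono_tags, lifting) ennreal_leI abs_ge_self infinity_ennreal_def leD nn_integral_mono top.not_eq_extremum)
  \<comment> \<open>Uniqueness of densities uses the finite total mass just shown. At each point one
    of the two parts of \<open>g\<close> is \<open>0\<close>, so their equality forces
    \<open>g x = 0\<close>.\<close>
  ultimately have "AE x in lborel. ennreal (g x) = ennreal (- g x)"
    by (subst finite_density_unique[symmetric]) auto
  then have "AE x in lborel. h x = 0"
    using gh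
  proof eventually_elim
    case (elim x)
    then show ?case by (cases "g x \<ge> 0") (auto simp: ennreal_neg)
  qed
  then show ?thesis by (rule AE_completion)
qed

text \<open>The bump functions converge pointwise to indicators of intervals \<open>{a<..<1}\<close>
  and stay between \<open>0\<close> and \<open>1\<close>; dominated convergence then gives vanishing
  integrals over rays for \<open>h\<close> cut off to the unit interval.\<close>

lemma AE_eq_0_of_test_functions:
  assumes int: "set_integrable lebesgue {0<..<1} h"
    and zero: "\<And>\<phi>. \<phi> \<in> test_functions \<Longrightarrow> unit_integral (\<lambda>x. h x * \<phi> x) = 0"
  shows "AE x in lebesgue. x \<in> {0<..<1} \<longrightarrow> h x = 0"
proof -
  have i: "integrable lebesgue (\<lambda>x. indicator {0<..<1} x * h x)"
    using int by (simp add: set_integrable_def)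
  have "AE x in lebesgue. indicator {0<..<1} x * h x = 0"
  proof (rule AE_eq_0_of_greaterThan_integrals[OF i])
    fix a0 :: real
    \<comment> \<open>The cut-off function vanishes left of \<open>0\<close>, so the ray may start
      at \<open>0\<close> or later.\<close>
    define a where "a = max a0 0"
    \<comment> \<open>Shrinking the interval by \<open>1 / real (Suc n)\<close> at both ends keeps
      the support away from \<open>0\<close> and \<open>1\<close>; \<open>Suc n\<close> avoids
      division by zero.\<close>
    define p where "p = (\<lambda>n x. (max 0 (x - (a + 1 / real (Suc n))))\<^sup>2 * (max 0 ((1 - 1 / real (Suc n)) - x))\<^sup>2)"
    define \<phi> where "\<phi> = (\<lambda>n x. real n * p n x / (1 + real n * p n x))"
    have tf: "\<phi> n \<in> test_functions" for n
      unfolding \<phi>_def p_def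
      by (rule bump_test_function) (auto simp: a_def max_def add_nonneg_pos)
    have p0: "p n x \<ge> 0" for n x by (simp add: p_def)
    have bd: "0 \<le> \<phi> n x" "\<phi> n x \<le> 1" for n x
    proof -
      have "real n * p n x \<ge> 0" using p0[of n x] by simp
      then show "0 \<le> \<phi> n x" "\<phi> n x \<le> 1" by (simp_all add: \<phi>_def)
    qed
    have lim: "(\<lambda>n. \<phi> n x) \<longlonglongrightarrow> indicator {a<..<1} x" for x
    proof (cases "x \<in> {a<..<1}")
      case True
      \<comment> \<open>Inside the interval \<open>p n x\<close> has a positive limit, so
        \<open>n * p n x\<close> tends to infinity and
        \<open>\<phi> n x = 1 - 1 / (1 + n * p n x)\<close> tends to \<open>1\<close>.\<close>
      have "(\<lambda>n. p n x) \<longlonglongrightarrow> (max 0 (x - (a + 0)))\<^sup>2 * (max 0 ((1 - 0) - x))\<^sup>2"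
        unfolding p_def by (intro tendsto_intros LIMSEQ_Suc[OF lim_1_over_n])
      moreover have "(max 0 (x - (a + 0)))\<^sup>2 * (max 0 ((1 - 0) - x))\<^sup>2 > 0" using True by (auto simp: max_def)
      ultimately have "filterlim (\<lambda>n. p n x * real n) at_top sequentially"
        using filterlim_tendsto_pos_mult_at_top filterlim_real_sequentially by blast
      then have "filterlim (\<lambda>n. 1 + p n x * real n) at_top sequentially"
        by (rule filterlim_tendsto_add_at_top[OF tendsto_const])
      then have "(\<lambda>n. 1 - inverse (1 + p n x * real n)) \<longlonglongrightarrow> 1 - 0"
        by (intro tendsto_diff tendsto_const tendsto_inverse_0_at_top)
      moreover have "1 - inverse (1 + p n x * real n) = \<phi> n x" for n
      proof -
        have "1 + real n * p n x > 0" using p0[of n x] by (simp add: add_pos_nonneg)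
        then show ?thesis by (simp add: \<phi>_def field_simps)
      qed
      ultimately show ?thesis using True by simp
    next
      case False
      have "p n x = 0" for n
      proof -
        have e: "1 / real (Suc n) > 0" by simp
        have "x - (a + 1 / real (Suc n)) \<le> 0 \<or> (1 - 1 / real (Suc n)) - x \<le> 0"
          using False e by (simp only: greaterThanLessThan_iff) linarith
        then show ?thesis unfolding p_def by (metis max_absorb1 mult_zero_left mult_zero_right zero_power2)
      qed
      then show ?thesis using False by (simp add: \<phi>_def)
    qed
    have m: "(\<lambda>x. indicator {0<..<1} x * h x) \<in> borel_measurable lebesgue" using i by auto
    have pm: "\<phi> n \<in> borel_measurable lebesgue" for n
    proof -
      have "\<phi> n \<in> borel_measurable borel" unfolding \<phi>_def p_def by measurable
      then show ?thesis by (metis measurable_completion measurable_lborel2)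
    qed
    have "(\<lambda>n. \<integral>x. (indicator {0<..<1} x * h x) * \<phi> n x \<partial>lebesgue) \<longlonglongrightarrow>
        (\<integral>x. (indicator {0<..<1} x * h x) * indicator {a<..<1} x \<partial>lebesgue)"
    proof (rule integral_dominated_convergence)
      show "integrable lebesgue (\<lambda>x. \<bar>indicator {0<..<1} x * h x\<bar>)" using i by (rule integrable_abs)
      show "AE x in lebesgue. norm (indicator {0<..<1} x * h x * \<phi> n x) \<le> \<bar>indicator {0<..<1} x * h x\<bar>" for n
        using bd by (auto simp: abs_mult intro!: AE_I2 mult_left_le)
      show "AE x in lebesgue. (\<lambda>n. indicator {0<..<1} x * h x * \<phi> n x) \<longlonglongrightarrow> indicator {0<..<1} x * h x * indicator {a<..<1} x"
        by (intro AE_I2 tendsto_mult tendsto_const lim)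
      show "(\<lambda>x. indicator {0<..<1} x * h x * indicator {a<..<1} x) \<in> borel_measurable lebesgue"
        by (rule borel_measurable_times[OF m borel_measurable_indicator]) simp
      show "(\<lambda>x. indicator {0<..<1} x * h x * \<phi> n x) \<in> borel_measurable lebesgue" for n
        using m pm[of n] by (rule borel_measurable_times)
    qed
    moreover have "(\<integral>x. (indicator {0<..<1} x * h x) * \<phi> n x \<partial>lebesgue) = 0" for n
      using zero[OF tf[of n]] by (simp add: set_lebesgue_integral_def mult.assoc)
    ultimately have "(\<integral>x. (indicator {0<..<1} x * h x) * indicator {a<..<1} x \<partial>lebesgue) = 0"
      by (simp add: LIMSEQ_const_iff)
    moreover have "(indicator {0<..<1} x * h x) * indicator {a<..<1} x = indicator {a0<..} x * (indicator {0<..<1} x * h x)" for x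
      by (auto simp: indicator_def a_def)
    ultimately show "(LINT x:{a0<..}|lebesgue. indicator {0<..<1} x * h x) = 0"
      by (simp add: set_lebesgue_integral_def)
  qed
  then show ?thesis by eventually_elim auto
qed

section \<open>Square integrability and the passage to gauge integrals\<close>

lemma L2_mult_integrable:
  assumes "f \<in> L2" "g \<in> L2"
  shows "set_integrable lebesgue {0<..<1} (\<lambda>x. f x * g x)"
proof (rule set_integrable_bound)
  show "set_integrable lebesgue {0<..<1} (\<lambda>x. (f x)\<^sup>2 + (g x)\<^sup>2)"
    using assms by (auto simp: L2_def intro: set_integral_add)
  have "(\<lambda>x. (indicator {0<..<1} x *\<^sub>R f x) * (indicator {0<..<1} x *\<^sub>R g x)) \<in> borel_measurable lebesgue"
    using assms by (intro borel_measurable_times) (auto simp: L2_def set_borel_measurable_def)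
  moreover have "(indicator {0<..<1} x *\<^sub>R f x) * (indicator {0<..<1} x *\<^sub>R g x) = indicator {0<..<1} x *\<^sub>R (f x * g x)" for x
    by (auto simp: indicator_def)
  ultimately show "set_borel_measurable lebesgue {0<..<1} (\<lambda>x. f x * g x)"
    by (simp only: set_borel_measurable_def)
  have "\<bar>f x * g x\<bar> \<le> (f x)\<^sup>2 + (g x)\<^sup>2" for x
  proof -
    have "0 \<le> (\<bar>f x\<bar> - \<bar>g x\<bar>)\<^sup>2" by simp
    then have "2 * \<bar>f x * g x\<bar> \<le> (f x)\<^sup>2 + (g x)\<^sup>2" by (simp add: power2_diff abs_mult)
    then show ?thesis by linarith
  qed
  then show "AE x in lebesgue. x \<in> {0<..<1} \<longrightarrow> norm (f x * g x) \<le> norm ((f x)\<^sup>2 + (g x)\<^sup>2)"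
    by (intro AE_I2) simp
qed

text \<open>The definitions use Lebesgue integrals over open intervals, whereas the fundamental
  theorem, integration by parts and differentiation under the integral are applied to gauge
  integrals over closed ones; this is the bridge.\<close>

lemma lebesgue_integral_continuous_Ioo:
  fixes f :: "real \<Rightarrow> real"
  assumes "continuous_on {a..b} f"
  shows "set_integrable lebesgue {a<..<b} f" "(LINT x:{a<..<b}|lebesgue. f x) = integral {a..b} f"
proof -
  show 1: "set_integrable lebesgue {a<..<b} f"
    by (rule set_integrable_subset[OF absolutely_integrable_continuous_real[OF assms]]) auto
  show "(LINT x:{a<..<b}|lebesgue. f x) = integral {a..b} f"
    using set_lebesgue_integral_eq_integral(2)[OF 1] by (simp add: integral_open_interval_real)
qed

lemma continuous_in_L2:
  fixes f :: "real \<Rightarrow> real"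
  assumes "continuous_on {0..1} f"
  shows "f \<in> L2"
  using lebesgue_integral_continuous_Ioo(1)[OF assms] lebesgue_integral_continuous_Ioo(1)[of 0 1 "\<lambda>x. (f x)\<^sup>2"] assms
  by (auto simp: L2_def set_integrable_def set_borel_measurable_def intro!: continuous_intros)

lemma set_lebesgue_integral_cong_AE_on:
  fixes f g :: "real \<Rightarrow> real"
  assumes "set_borel_measurable M A f" "set_borel_measurable M A g" "AE x\<in>A in M. f x = g x"
  shows "(LINT x:A|M. f x) = (LINT x:A|M. g x)"
  unfolding set_lebesgue_integral_def
proof (rule integral_cong_AE)
  show "AE x in M. indicator A x *\<^sub>R f x = indicator A x *\<^sub>R g x"
    using assms(3) by eventually_elim (auto simp: indicator_def)
qed (use assms in \<open>auto simp: set_borel_measurable_def\<close>)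

lemma set_borel_measurable_comp:
  fixes f :: "_ \<Rightarrow> real" and F :: "real \<Rightarrow> real"
  assumes "A \<in> sets M" "set_borel_measurable M A f" "continuous_on UNIV F"
  shows "set_borel_measurable M A (\<lambda>x. F (f x))"
proof -
  have [measurable]: "(\<lambda>x. indicator A x *\<^sub>R f x) \<in> borel_measurable M"
    using assms(2) by (simp add: set_borel_measurable_def)
  have [measurable]: "F \<in> borel_measurable borel" by (rule borel_measurable_continuous_onI) fact
  note assms(1)[measurable]
  \<comment> \<open>The outer indicator is present because \<open>F 0\<close> may differ from
    \<open>0\<close>.\<close>
  have "(\<lambda>x. indicator A x *\<^sub>R F (indicator A x *\<^sub>R f x)) \<in> borel_measurable M"
    by measurable
  moreover have "indicator A x *\<^sub>R F (indicator A x *\<^sub>R f x) = indicator A x *\<^sub>R F (f x)" for x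
    by (auto simp: indicator_def)
  ultimately show ?thesis by (simp only: set_borel_measurable_def)
qed

text \<open>\<open>wderiv\<close> is determined only almost everywhere. This replaces it by a
  classical derivative under the nonlinear integrands that occur: squares,
  \<open>sqrt (1 + p\<^sup>2)\<close> and \<open>p / sqrt (1 + p\<^sup>2)\<close>.\<close>

lemma lebesgue_integral_comp_AE_eq:
  fixes f g F :: "real \<Rightarrow> real"
  assumes "set_borel_measurable lebesgue {a<..<b} f" "continuous_on {a..b} g"
    "AE x\<in>{a<..<b} in lebesgue. f x = g x" "continuous_on UNIV F"
  shows "(LINT x:{a<..<b}|lebesgue. F (f x)) = integral {a..b} (\<lambda>x. F (g x))"
proof -
  have c: "continuous_on {a..b} (\<lambda>x. F (g x))"
    by (rule continuous_on_compose2[OF assms(4,2)]) simp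
  have "(LINT x:{a<..<b}|lebesgue. F (f x)) = (LINT x:{a<..<b}|lebesgue. F (g x))"
  proof (rule set_lebesgue_integral_cong_AE_on)
    show "set_borel_measurable lebesgue {a<..<b} (\<lambda>x. F (f x))"
      by (rule set_borel_measurable_comp) (use assms in auto)
    show "set_borel_measurable lebesgue {a<..<b} (\<lambda>x. F (g x))"
      using lebesgue_integral_continuous_Ioo(1)[OF c] by (auto simp: set_integrable_def set_borel_measurable_def)
    show "AE x\<in>{a<..<b} in lebesgue. F (f x) = F (g x)"
      using assms(3) by eventually_elim auto
  qed
  then show ?thesis using lebesgue_integral_continuous_Ioo(2)[OF c] by simp
qed

section \<open>Uniqueness of weak derivatives and agreement with classical ones\<close>

lemma test_functionD:
  assumes "\<phi> \<in> test_functions"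
  shows "(\<phi> has_real_derivative deriv \<phi> x) (at x)" "continuous_on UNIV (deriv \<phi>)"
    "continuous_on UNIV \<phi>" "\<phi> 0 = 0" "\<phi> 1 = 0"
proof -
  obtain D where D: "\<And>x. (\<phi> has_real_derivative D x) (at x)" "continuous_on UNIV D"
    using assms by (auto simp: test_functions_def C1_differentiable_on_def has_real_derivative_iff_has_vector_derivative)
  then have "deriv \<phi> = D" by (auto simp: DERIV_imp_deriv)
  then show d: "(\<phi> has_real_derivative deriv \<phi> x) (at x)" "continuous_on UNIV (deriv \<phi>)" for x
    using D by auto
  show "continuous_on UNIV \<phi>"
    using d(1) by (meson DERIV_continuous continuous_at_imp_continuous_on)
  have "\<phi> x = 0" if "x \<notin> {0<..<1}" for x
    using assms that closure_subset[of "{x. \<phi> x \<noteq> 0}"] by (auto simp: test_functions_def)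
  from this[of 0] this[of 1] show "\<phi> 0 = 0" "\<phi> 1 = 0" by auto
qed

lemma weak_deriv_unique:
  assumes "weak_deriv f g" "weak_deriv f h"
  shows "AE x\<in>{0<..<1} in lebesgue. g x = h x"
proof -
  have gh: "g \<in> L2" "h \<in> L2" using assms by (auto simp: weak_deriv_def)
  \<comment> \<open>Multiplying by this constant turns \<open>L2_mult_integrable\<close> into
    integrability of \<open>g\<close> and \<open>h\<close> themselves.\<close>
  have L2_1: "(\<lambda>x. 1) \<in> L2" by (rule continuous_in_L2) simp
  have "AE x in lebesgue. x \<in> {0<..<1} \<longrightarrow> g x - h x = 0"
  proof (rule AE_eq_0_of_test_functions)
    show "set_integrable lebesgue {0<..<1} (\<lambda>x. g x - h x)"
      using set_integral_diff(1)[OF L2_mult_integrable[OF gh(1) L2_1] L2_mult_integrable[OF gh(2) L2_1]] by simp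
    fix \<phi> :: "real \<Rightarrow> real" assume \<phi>: "\<phi> \<in> test_functions"
    have "\<phi> \<in> L2"
      using test_functionD(3)[OF \<phi>] by (intro continuous_in_L2) (rule continuous_on_subset, auto)
    from set_integral_diff(2)[OF L2_mult_integrable[OF gh(1) this] L2_mult_integrable[OF gh(2) this]]
    show "unit_integral (\<lambda>x. (g x - h x) * \<phi> x) = 0"
      using assms \<phi> by (simp add: weak_deriv_def algebra_simps)
  qed
  then show ?thesis by eventually_elim auto
qed

text \<open>Integration by parts, with boundary terms killed by the test function. Equality of
  \<open>f\<close> and \<open>F\<close> is asked only almost everywhere so that
  \<open>wderiv f\<close> can later take the place of \<open>f\<close>, which gives second
  derivatives.\<close>

lemma weak_deriv_C1:
  fixes f F F' :: "real \<Rightarrow> real"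
  assumes F: "continuous_on {0..1} F" "\<And>x. x \<in> {0<..<1} \<Longrightarrow> (F has_real_derivative F' x) (at x)"
    and F': "continuous_on {0..1} F'"
    and f: "set_borel_measurable lebesgue {0<..<1} f" "AE x\<in>{0<..<1} in lebesgue. f x = F x"
  shows "weak_deriv f F'"
proof -
  have "F \<in> L2" by (rule continuous_in_L2) fact
  have mono: "set_integrable lebesgue {0<..<1} (\<lambda>x. (f x)\<^sup>2)"
  proof (rule set_integrable_bound)
    show "set_integrable lebesgue {0<..<1} (\<lambda>x. (F x)\<^sup>2)" using \<open>F \<in> L2\<close> by (simp add: L2_def)
    show "set_borel_measurable lebesgue {0<..<1} (\<lambda>x. (f x)\<^sup>2)"
      using set_borel_measurable_comp[OF _ f(1), of "\<lambda>x. x\<^sup>2"] by (simp add: continuous_intros)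
    show "AE x in lebesgue. x \<in> {0<..<1} \<longrightarrow> norm ((f x)\<^sup>2) \<le> norm ((F x)\<^sup>2)"
      using f(2) by eventually_elim auto
  qed
  have "f \<in> L2" using f mono by (simp add: L2_def)
  moreover have "F' \<in> L2" by (rule continuous_in_L2) fact
  moreover have "unit_integral (\<lambda>x. f x * deriv \<phi> x) = - unit_integral (\<lambda>x. F' x * \<phi> x)"
    if \<phi>: "\<phi> \<in> test_functions" for \<phi>
  proof -
    note \<phi>' = test_functionD[OF \<phi>]
    have c: "continuous_on {0..1} \<phi>" "continuous_on {0..1} (deriv \<phi>)"
      using \<phi>'(2,3) continuous_on_subset by blast+
    have c1: "continuous_on {0..1} (\<lambda>x. F x * deriv \<phi> x)" "continuous_on {0..1} (\<lambda>x. F' x * \<phi> x)"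
      using c F F' by (auto intro!: continuous_intros)
    have "unit_integral (\<lambda>x. f x * deriv \<phi> x) = unit_integral (\<lambda>x. F x * deriv \<phi> x)"
    proof (rule set_lebesgue_integral_cong_AE_on)
      show "set_borel_measurable lebesgue {0<..<1} (\<lambda>x. f x * deriv \<phi> x)"
        using L2_mult_integrable[OF \<open>f \<in> L2\<close> continuous_in_L2[OF c(2)]] by (auto simp: set_integrable_def set_borel_measurable_def)
      show "set_borel_measurable lebesgue {0<..<1} (\<lambda>x. F x * deriv \<phi> x)"
        using L2_mult_integrable[OF \<open>F \<in> L2\<close> continuous_in_L2[OF c(2)]] by (auto simp: set_integrable_def set_borel_measurable_def)
      show "AE x\<in>{0<..<1} in lebesgue. f x * deriv \<phi> x = F x * deriv \<phi> x"
        using f(2) by eventually_elim auto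
    qed
    also have "\<dots> = integral {0..1} (\<lambda>x. F x * deriv \<phi> x)"
      by (rule lebesgue_integral_continuous_Ioo(2)) fact
    also have "\<dots> = - integral {0..1} (\<lambda>x. F' x * \<phi> x)"
    proof -
      let ?I = "integral {0..1} (\<lambda>x. F x * deriv \<phi> x)"
      have "((\<lambda>x. F' x * \<phi> x) has_integral - ?I) {0..1}"
      proof (rule integration_by_parts_interior[OF bounded_bilinear_mult])
        show "((\<lambda>x. F x * deriv \<phi> x) has_integral F 1 * \<phi> 1 - F 0 * \<phi> 0 - - ?I) {0..1}"
          using integrable_integral[OF integrable_continuous_real[OF c1(1)]] \<phi>'(4,5) by simp
      qed (use F c \<phi>'(1) in \<open>auto simp: has_real_derivative_iff_has_vector_derivative[symmetric]\<close>)
      then show ?thesis by (simp add: integral_unique)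
    qed
    also have "integral {0..1} (\<lambda>x. F' x * \<phi> x) = unit_integral (\<lambda>x. F' x * \<phi> x)"
      by (rule lebesgue_integral_continuous_Ioo(2)[symmetric]) fact
    finally show ?thesis .
  qed
  ultimately show ?thesis by (simp add: weak_deriv_def)
qed

text \<open>\<open>F'\<close> witnesses that a weak derivative exists, so the choice in
  \<open>wderiv\<close> yields one; uniqueness then identifies it with \<open>F'\<close> almost
  everywhere.\<close>

lemma wderiv_C1:
  fixes f F F' :: "real \<Rightarrow> real"
  assumes "continuous_on {0..1} F" "\<And>x. x \<in> {0<..<1} \<Longrightarrow> (F has_real_derivative F' x) (at x)"
    "continuous_on {0..1} F'"
    "set_borel_measurable lebesgue {0<..<1} f" "AE x\<in>{0<..<1} in lebesgue. f x = F x"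
  shows "set_borel_measurable lebesgue {0<..<1} (wderiv f)"
    "AE x\<in>{0<..<1} in lebesgue. wderiv f x = F' x"
proof -
  have 1: "weak_deriv f F'" by (rule weak_deriv_C1) fact+
  then have 2: "weak_deriv f (wderiv f)" unfolding wderiv_def by (rule someI[of "weak_deriv f"])
  then show "set_borel_measurable lebesgue {0<..<1} (wderiv f)" by (simp add: weak_deriv_def L2_def)
  show "AE x\<in>{0<..<1} in lebesgue. wderiv f x = F' x" using 2 1 by (rule weak_deriv_unique)
qed

text \<open>\<open>wderiv_C1\<close> is applied twice. Comparing \<open>f\<close> with
  \<open>F\<close> on the open interval only suits the energy gradient, which is matched with a
  classical primitive only there.\<close>

lemma norm_H2_C2:
  fixes f F F' F'' :: "real \<Rightarrow> real"
  assumes "continuous_on {0..1} F" "\<And>x. x \<in> {0<..<1} \<Longrightarrow> (F has_real_derivative F' x) (at x)"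
    "continuous_on {0..1} F'" "\<And>x. x \<in> {0<..<1} \<Longrightarrow> (F' has_real_derivative F'' x) (at x)"
    "continuous_on {0..1} F''"
    "\<And>x. x \<in> {0<..<1} \<Longrightarrow> f x = F x"
  shows "(norm_H2 f)\<^sup>2 = integral {0..1} (\<lambda>x. (F' x)\<^sup>2) + integral {0..1} (\<lambda>x. (F'' x)\<^sup>2)"
proof -
  have m: "set_borel_measurable lebesgue {0<..<1} f"
  proof -
    have "indicator {0<..<1} x *\<^sub>R f x = indicator {0<..<1} x *\<^sub>R F x" for x
      using assms(6) by (auto simp: indicator_def)
    moreover have "set_borel_measurable lebesgue {0<..<1} F"
      using continuous_in_L2[OF assms(1)] by (simp add: L2_def)
    ultimately show ?thesis by (simp only: set_borel_measurable_def)
  qed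
  have ae: "AE x\<in>{0<..<1} in lebesgue. f x = F x" using assms(6) by (intro AE_I2) auto
  note w1 = wderiv_C1[OF assms(1-3) m ae]
  note w2 = wderiv_C1[OF assms(3-5) w1]
  have sq: "continuous_on UNIV (\<lambda>x::real. x\<^sup>2)" by (intro continuous_intros)
  have "unit_integral (\<lambda>x. (wderiv f x)\<^sup>2) = integral {0..1} (\<lambda>x. (F' x)\<^sup>2)"
    by (rule lebesgue_integral_comp_AE_eq[OF w1(1) assms(3) w1(2) sq])
  moreover have "unit_integral (\<lambda>x. (wderiv (wderiv f) x)\<^sup>2) = integral {0..1} (\<lambda>x. (F'' x)\<^sup>2)"
    by (rule lebesgue_integral_comp_AE_eq[OF w2(1) assms(5) w2(2) sq])
  ultimately have "norm_H2 f = sqrt (integral {0..1} (\<lambda>x. (F' x)\<^sup>2) + integral {0..1} (\<lambda>x. (F'' x)\<^sup>2))"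
    by (simp add: norm_H2_def)
  moreover have "integral {0..1} (\<lambda>x. (F' x)\<^sup>2) + integral {0..1} (\<lambda>x. (F'' x)\<^sup>2) \<ge> 0"
    using assms by (intro add_nonneg_nonneg integral_nonneg integrable_continuous_real continuous_intros) auto
  ultimately show ?thesis by simp
qed

section \<open>Scalar decay under a Lojasiewicz inequality\<close>

lemma antimono_of_DERIV_nonpos:
  fixes f :: "real \<Rightarrow> real"
  assumes "a \<le> b" "\<And>x. a \<le> x \<Longrightarrow> x \<le> b \<Longrightarrow> \<exists>y. (f has_real_derivative y) (at x) \<and> y \<le> 0"
  shows "f b \<le> f a"
  using DERIV_nonpos_imp_nonincreasing[of a b f] assms by blast

text \<open>\<open>H\<close> models the energy minus its equilibrium value and \<open>D\<close> its
  rate of decay. The bound \<open>B\<close> serves to exclude negative values of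
  \<open>H\<close>.\<close>

locale lojasiewicz_flow =
  fixes H D :: "real \<Rightarrow> real" and c \<theta> B :: real
  assumes theta: "0 < \<theta>" "\<theta> < 1" and c: "c > 0"
    and deriv_H: "\<And>t. t > 0 \<Longrightarrow> (H has_real_derivative - D t) (at t)"
    and D_nonneg: "\<And>t. t > 0 \<Longrightarrow> D t \<ge> 0"
    and D_ge: "\<And>t. t > 0 \<Longrightarrow> sqrt (D t) \<ge> c * \<bar>H t\<bar> powr (1 - \<theta>)"
    and H_ge: "\<And>t. t > 0 \<Longrightarrow> H t \<ge> B"
begin

lemma H_antimono:
  assumes "0 < t" "t \<le> s" shows "H s \<le> H t"
proof (rule antimono_of_DERIV_nonpos[OF assms(2)])
  fix x assume "t \<le> x"
  then have "x > 0" using assms by simp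
  from deriv_H[OF this] D_nonneg[OF this]
  show "\<exists>y. (H has_real_derivative y) (at x) \<and> y \<le> 0" by (intro exI[of _ "- D x"]) simp
qed

text \<open>Once negative, \<open>H\<close> would decrease at least linearly.\<close>

lemma H_nonneg:
  assumes "t > 0" shows "H t \<ge> 0"
proof (rule ccontr)
  assume neg: "\<not> H t \<ge> 0"
  \<comment> \<open>A lower bound for \<open>D\<close> at all later times: \<open>H\<close> is
    negative and decreasing, so \<open>\<bar>H\<bar>\<close> only grows.\<close>
  define d where "d = (c * \<bar>H t\<bar> powr (1 - \<theta>))\<^sup>2"
  have d: "d > 0" using neg c by (simp add: d_def)
  have decay: "H s + d * s \<le> H t + d * t" if "s \<ge> t" for s
  proof (rule antimono_of_DERIV_nonpos[OF that])
    fix x assume x: "t \<le> x" "x \<le> s"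
    then have x0: "x > 0" using assms by simp
    have "\<bar>H t\<bar> \<le> \<bar>H x\<bar>" using H_antimono[OF assms x(1)] neg by linarith
    then have "c * \<bar>H t\<bar> powr (1 - \<theta>) \<le> c * \<bar>H x\<bar> powr (1 - \<theta>)"
      using c theta by (intro mult_left_mono powr_mono2) auto
    also have "\<dots> \<le> sqrt (D x)" by (rule D_ge[OF x0])
    finally have "d \<le> (sqrt (D x))\<^sup>2"
      unfolding d_def using c by (intro power_mono) auto
    then have "d \<le> D x" using D_nonneg[OF x0] by simp
    moreover have "((\<lambda>s. H s + d * s) has_real_derivative - D x + d) (at x)"
      using DERIV_add[OF deriv_H[OF x0] DERIV_cmult_Id] .
    ultimately show "\<exists>y. ((\<lambda>s. H s + d * s) has_real_derivative y) (at x) \<and> y \<le> 0"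
      by (intro exI[of _ "- D x + d"]) simp
  qed
  \<comment> \<open>At this time the linear upper bound for \<open>H\<close> has come down to
    \<open>B - 1\<close>.\<close>
  define s where "s = t + (H t - B + 1) / d"
  have "s \<ge> t" using H_ge[OF assms] d by (simp add: s_def)
  moreover have "d * s = d * t + (H t - B + 1)" using d by (simp add: s_def field_simps)
  ultimately have "H s < B" using decay[of s] by linarith
  then show False using H_ge[of s] assms \<open>s \<ge> t\<close> by linarith
qed

text \<open>Being decreasing and nonnegative, \<open>H\<close> stays at \<open>0\<close> once it
  gets there, so its derivative \<open>- D\<close> vanishes afterwards.\<close>

lemma D_eq_0:
  assumes "t > 0" "H t = 0" "s > t" shows "D s = 0"
proof -
  have "H x = 0" if "x > t" for x
    using H_antimono[of t x] H_nonneg[of x] assms that by linarith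
  then have "(H has_real_derivative 0) (at s)"
    by (intro has_field_derivative_transform_within_open[OF DERIV_const[of 0], where S="{t<..}"]) (use assms in auto)
  moreover have "(H has_real_derivative - D s) (at s)" using assms by (intro deriv_H) simp
  ultimately have "0 = - D s" by (rule DERIV_unique)
  then show ?thesis by simp
qed

text \<open>While \<open>H\<close> is positive, \<open>H powr \<theta>\<close> has derivative
  \<open>- \<theta> * H powr (\<theta> - 1) * D\<close>. Writing \<open>D\<close> as
  \<open>sqrt D * sqrt D\<close> and bounding one factor below by
  \<open>c * H powr (1 - \<theta>)\<close> makes this at most
  \<open>- c * \<theta> * sqrt D\<close>, which outweighs \<open>g'\<close> after scaling by
  \<open>K / (c * \<theta>)\<close>.\<close>

lemma increment_le_pos:
  assumes g: "\<And>t. t > 0 \<Longrightarrow> (g has_real_derivative g' t) (at t)"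
    "\<And>t. t > 0 \<Longrightarrow> g' t \<le> K * sqrt (D t)" and K: "K \<ge> 0"
    and ts: "0 < t" "t \<le> s" "H s > 0"
  shows "g s + K / (c * \<theta>) * H s powr \<theta> \<le> g t + K / (c * \<theta>) * H t powr \<theta>"
proof (rule antimono_of_DERIV_nonpos[OF ts(2)])
  fix x assume x: "t \<le> x" "x \<le> s"
  then have x0: "x > 0" and Hx: "H x > 0" using ts H_antimono[of x s] by auto
  let ?d = "g' x + K / (c * \<theta>) * (\<theta> * H x powr (\<theta> - 1) * (- D x))"
  have "((\<lambda>x. g x + K / (c * \<theta>) * H x powr \<theta>) has_real_derivative ?d) (at x)"
    using DERIV_add[OF g(1)[OF x0] DERIV_cmult[OF DERIV_chain2[where f="\<lambda>z. z powr \<theta>", OF has_real_derivative_powr[OF Hx] deriv_H[OF x0]]]] .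
  moreover have "?d \<le> 0"
  proof -
    have "c * H x powr (1 - \<theta>) * sqrt (D x) \<le> sqrt (D x) * sqrt (D x)"
      using D_ge[OF x0] Hx D_nonneg[OF x0] by (intro mult_right_mono) auto
    also have "\<dots> = D x" using D_nonneg[OF x0] by simp
    finally have "H x powr (\<theta> - 1) * (c * H x powr (1 - \<theta>) * sqrt (D x)) \<le> H x powr (\<theta> - 1) * D x"
      by (intro mult_left_mono) auto
    also have "H x powr (\<theta> - 1) * (c * H x powr (1 - \<theta>) * sqrt (D x)) = c * sqrt (D x) * (H x powr (\<theta> - 1) * H x powr (1 - \<theta>))"
      by simp
    also have "H x powr (\<theta> - 1) * H x powr (1 - \<theta>) = 1"
      using Hx by (simp add: powr_add[symmetric])
    finally have "sqrt (D x) \<le> H x powr (\<theta> - 1) * D x / c"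
      using c by (simp add: field_simps)
    then have "K * sqrt (D x) \<le> K * (H x powr (\<theta> - 1) * D x / c)"
      using K by (rule mult_left_mono)
    moreover have "K / (c * \<theta>) * (\<theta> * H x powr (\<theta> - 1) * (- D x)) = - (K * (H x powr (\<theta> - 1) * D x / c))"
      using theta c by simp
    ultimately show ?thesis using g(2)[OF x0] by linarith
  qed
  ultimately show "\<exists>y. ((\<lambda>x. g x + K / (c * \<theta>) * H x powr \<theta>) has_real_derivative y) (at x) \<and> y \<le> 0"
    by blast
qed

text \<open>\<open>H powr \<theta>\<close> need not be differentiable where \<open>H\<close>
  vanishes, so the time interval is split at the first zero of \<open>H\<close>: before it the
  previous lemma applies, after it \<open>D = 0\<close> and \<open>g\<close> cannot
  increase.\<close>

lemma increment_le:
  assumes g: "\<And>t. t > 0 \<Longrightarrow> (g has_real_derivative g' t) (at t)"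
    "\<And>t. t > 0 \<Longrightarrow> g' t \<le> K * sqrt (D t)" and K: "K \<ge> 0"
    and ts: "0 < t" "t \<le> s"
  shows "g s - g t \<le> K / (c * \<theta>) * H t powr \<theta>"
proof (cases "H s > 0")
  case True
  have "K / (c * \<theta>) * H s powr \<theta> \<ge> 0" using K c theta by simp
  then show ?thesis using increment_le_pos[OF g K ts True] by linarith
next
  case False
  then have Hs: "H s = 0" using H_nonneg[of s] ts by linarith
  define Z where "Z = {x \<in> {t..s}. H x = 0}"
  \<comment> \<open>The first zero of \<open>H\<close> in \<open>{t..s}\<close>; the infimum is
    attained because \<open>Z\<close> is closed and contains \<open>s\<close>.\<close>
  define z where "z = Inf Z"
  have contH: "continuous_on {t..s} H"
    by (rule continuous_at_imp_continuous_on) (use ts in \<open>auto intro!: DERIV_isCont[OF deriv_H]\<close>)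
  have "closed Z" unfolding Z_def
    by (rule continuous_closed_preimage_constant) (use contH in auto)
  moreover have "s \<in> Z" using Hs ts by (simp add: Z_def)
  moreover have bdd: "bdd_below Z" by (auto simp: Z_def)
  ultimately have zZ: "z \<in> Z" unfolding z_def by (intro closed_contains_Inf) auto
  then have z: "t \<le> z" "z \<le> s" "H z = 0" by (auto simp: Z_def)
  have gs: "g s \<le> g z"
  proof (cases "z = s")
    case False
    then have "z < s" using z by simp
    have "(g has_real_derivative g' x) (at x)" if "z \<le> x" for x
      using that z ts by (intro g(1)) linarith
    then obtain x where x: "z < x" "x < s" "g s - g z = (s - z) * g' x"
      using MVT2[OF \<open>z < s\<close>, of g g'] by blast
    then have "D x = 0" using D_eq_0[of z x] z ts by simp
    moreover have "g' x \<le> K * sqrt (D x)" using x z ts by (intro g(2)) linarith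
    ultimately have "(s - z) * g' x \<le> 0" using x by (intro mult_nonneg_nonpos) auto
    then show ?thesis using x by linarith
  qed simp
  have gz: "g z \<le> g t + K / (c * \<theta>) * H t powr \<theta>"
  proof (cases "z = t")
    case True then show ?thesis using z K c theta by simp
  next
    case False
    then have tz: "t < z" using z by simp
    \<comment> \<open>The bound is uniform in \<open>x < z\<close>, so it passes to
      \<open>g z\<close> by continuity from the left.\<close>
    have "g x \<le> g t + K / (c * \<theta>) * H t powr \<theta>" if x: "t < x" "x < z" for x
    proof -
      have "x \<notin> Z" using cInf_lower[OF _ bdd, of x] x by (auto simp: z_def)
      then have "H x \<noteq> 0" using x z by (simp add: Z_def)
      then have "H x > 0" using H_nonneg[of x] x ts by linarith
      moreover have "K / (c * \<theta>) * H x powr \<theta> \<ge> 0" using K c theta by simp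
      ultimately show ?thesis using increment_le_pos[OF g K ts(1) less_imp_le[OF x(1)]] by linarith
    qed
    moreover have "(g \<longlongrightarrow> g z) (at_left z)"
      using DERIV_isCont[OF g(1)[of z]] tz ts by (simp add: isCont_def filterlim_at_split)
    moreover have "\<forall>\<^sub>F x in at_left z. t < x \<and> x < z"
      using eventually_at_left_real[OF tz] by simp
    then have "\<forall>\<^sub>F x in at_left z. g x \<le> g t + K / (c * \<theta>) * H t powr \<theta>"
      by (rule eventually_mono) (use calculation(1) in blast)
    ultimately show ?thesis
      using tendsto_upperbound[of g "g z" "at_left z"] trivial_limit_at_left_real by blast
  qed
  show ?thesis using gs gz by simp
qed

text \<open>The one-sided bound for \<open>g\<close> and for \<open>- g\<close>. It is used with
  \<open>g = \<alpha>\<close> and with the pairing of \<open>u\<close> against a fixed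
  function.\<close>

theorem abs_increment_le:
  assumes g: "\<And>t. t > 0 \<Longrightarrow> (g has_real_derivative g' t) (at t)"
    "\<And>t. t > 0 \<Longrightarrow> \<bar>g' t\<bar> \<le> K * sqrt (D t)" and K: "K \<ge> 0"
    and ts: "0 < t" "t \<le> s"
  shows "\<bar>g t - g s\<bar> \<le> K / (c * \<theta>) * \<bar>H t\<bar> powr \<theta>"
proof -
  have 1: "g s - g t \<le> K / (c * \<theta>) * H t powr \<theta>"
    using increment_le[OF g(1) abs_le_D1[OF g(2)] K ts] .
  have "((\<lambda>x. - g x) has_real_derivative - g' x) (at x)" if "x > 0" for x
    using g(1)[OF that] by (rule DERIV_minus)
  from increment_le[OF this abs_le_D2[OF g(2)] K ts] have 2: "- g s - - g t \<le> K / (c * \<theta>) * H t powr \<theta>" .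
  show ?thesis using 1 2 H_nonneg[OF ts(1)] by simp
qed

end

section \<open>Elementary inequalities and derivatives\<close>

text \<open>The integral of \<open>(f x - l * g x)\<^sup>2\<close> is a nonnegative quadratic
  polynomial in \<open>l\<close>.\<close>

lemma integral_Cauchy_Schwarz:
  fixes f g :: "real \<Rightarrow> real"
  assumes f: "continuous_on {a..b} f" and g: "continuous_on {a..b} g"
  shows "(integral {a..b} (\<lambda>x. f x * g x))\<^sup>2
    \<le> integral {a..b} (\<lambda>x. (f x)\<^sup>2) * integral {a..b} (\<lambda>x. (g x)\<^sup>2)"
proof -
  define F I G where "F = integral {a..b} (\<lambda>x. (f x)\<^sup>2)"
    and "I = integral {a..b} (\<lambda>x. f x * g x)" and "G = integral {a..b} (\<lambda>x. (g x)\<^sup>2)"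
  have int: "((\<lambda>x. (f x)\<^sup>2) has_integral F) {a..b}" "((\<lambda>x. f x * g x) has_integral I) {a..b}"
      "((\<lambda>x. (g x)\<^sup>2) has_integral G) {a..b}"
    unfolding F_def I_def G_def
    by (intro integrable_integral integrable_continuous_real continuous_intros f g)+
  have quad: "0 \<le> F - 2 * l * I + l\<^sup>2 * G" for l
  proof (rule has_integral_nonneg)
    show "((\<lambda>x. (f x)\<^sup>2 - 2 * l * (f x * g x) + l\<^sup>2 * (g x)\<^sup>2) has_integral F - 2 * l * I + l\<^sup>2 * G) {a..b}"
      by (intro has_integral_add has_integral_diff has_integral_mult_right int)
    have "(f x)\<^sup>2 - 2 * l * (f x * g x) + l\<^sup>2 * (g x)\<^sup>2 = (f x - l * g x)\<^sup>2" for x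
      by (simp add: power2_eq_square algebra_simps)
    then show "0 \<le> (f x)\<^sup>2 - 2 * l * (f x * g x) + l\<^sup>2 * (g x)\<^sup>2" for x by simp
  qed
  have "G \<ge> 0" using int(3) by (rule has_integral_nonneg) simp
  have "I\<^sup>2 \<le> F * G"
  proof (cases "G = 0")
    case True
    have "I = 0"
    proof (rule ccontr)
      assume "I \<noteq> 0"
      \<comment> \<open>With \<open>G = 0\<close> the polynomial is \<open>F - 2 * l * I\<close>,
        and this \<open>l\<close> gives it the value \<open>-1\<close>.\<close>
      then show False using quad[of "(F + 1) / (2 * I)"] True by simp
    qed
    then show ?thesis using True by simp
  next
    case False
    then have "G > 0" using \<open>G \<ge> 0\<close> by simp
    \<comment> \<open>\<open>I / G\<close> is the minimizer of the quadratic.\<close>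
    then show ?thesis using quad[of "I / G"] by (simp add: power2_eq_square field_simps)
  qed
  then show ?thesis by (simp add: F_def I_def G_def)
qed

text \<open>A Poincare inequality with constant \<open>1\<close>: \<open>f x\<close> is an integral
  of \<open>f'\<close> starting from the zero \<open>z\<close>, and Cauchy-Schwarz against the
  constant function \<open>1\<close> on the unit interval bounds its square.\<close>

lemma square_le_integral_deriv_square:
  fixes f f' :: "real \<Rightarrow> real"
  assumes f: "\<And>x. x \<in> {0..1} \<Longrightarrow> (f has_real_derivative f' x) (at x)"
    and f': "continuous_on {0..1} f'" and z: "z \<in> {0..1}" "f z = 0" and x: "x \<in> {0..1}"
  shows "(f x)\<^sup>2 \<le> integral {0..1} (\<lambda>x. (f' x)\<^sup>2)"
proof -
  have key: "\<bar>f b - f a\<bar> \<le> integral {0..1} (\<lambda>x. \<bar>f' x\<bar>)" if ab: "0 \<le> a" "a \<le> b" "b \<le> 1" for a b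
  proof -
    have c: "continuous_on {a..b} f'" using f' by (rule continuous_on_subset) (use ab in auto)
    have "(f' has_integral f b - f a) {a..b}"
    proof (rule fundamental_theorem_of_calculus[OF ab(2)])
      fix x assume "x \<in> {a..b}"
      then have "(f has_real_derivative f' x) (at x within {a..b})"
        using ab by (intro has_field_derivative_at_within[OF f]) simp
      then show "(f has_vector_derivative f' x) (at x within {a..b})"
        by (simp only: has_real_derivative_iff_has_vector_derivative)
    qed
    then have "\<bar>f b - f a\<bar> = \<bar>integral {a..b} f'\<bar>" by (simp add: integral_unique)
    also have "\<dots> \<le> integral {a..b} (\<lambda>x. \<bar>f' x\<bar>)"
      using integral_norm_bound_integral[of f' "{a..b}" "\<lambda>x. \<bar>f' x\<bar>"] c
      by (simp add: integrable_continuous_real continuous_intros)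
    also have "\<dots> \<le> integral {0..1} (\<lambda>x. \<bar>f' x\<bar>)"
      by (intro integral_subset_le integrable_continuous_real continuous_intros f' c) (use ab in auto)
    finally show ?thesis .
  qed
  have "\<bar>f x\<bar> \<le> integral {0..1} (\<lambda>x. \<bar>f' x\<bar>)"
    using key[of x z] key[of z x] x z by (cases "x \<le> z") auto
  then have "(f x)\<^sup>2 \<le> (integral {0..1} (\<lambda>x. \<bar>f' x\<bar>))\<^sup>2"
    using power_mono[of "\<bar>f x\<bar>" _ 2] by simp
  also have "\<dots> \<le> integral {0..1} (\<lambda>x. (f' x)\<^sup>2)"
    using integral_Cauchy_Schwarz[of 0 1 "\<lambda>x. \<bar>f' x\<bar>" "\<lambda>x. 1"] f' by (simp add: continuous_intros)
  finally show ?thesis .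
qed

lemma real_analytic_imp_DERIV:
  assumes "real_analytic f"
  shows "(f has_real_derivative deriv f x) (at x)"
proof -
  obtain F where F: "fps_conv_radius F > 0" "\<forall>\<^sub>F h in nhds 0. eval_fps F h = f (x + h)"
    using assms by (auto simp: real_analytic_def has_fps_expansion_def)
  have "(eval_fps F has_real_derivative eval_fps (fps_deriv F) 0) (at 0)"
    by (rule has_field_derivative_eval_fps) (use F in \<open>simp add: zero_ereal_def\<close>)
  then have "((\<lambda>h. f (x + h)) has_real_derivative eval_fps (fps_deriv F) 0) (at 0)"
    using DERIV_cong_ev[OF refl F(2) refl] by simp
  then have "(f has_real_derivative eval_fps (fps_deriv F) 0) (at x)"
    by (simp add: DERIV_shift[of f _ 0 x, symmetric] add.commute)
  then show ?thesis using DERIV_deriv_iff_real_differentiable real_differentiable_def by blast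
qed

text \<open>Convexity of \<open>sqrt (1 + p\<^sup>2)\<close>, in the form of the tangent at
  \<open>q\<close>. After multiplication by \<open>sqrt (1 + q\<^sup>2)\<close> it is the
  Cauchy-Schwarz inequality for the vectors \<open>(1, p)\<close> and \<open>(1, q)\<close>.\<close>

lemma sqrt_one_plus_square_tangent:
  fixes p q :: real
  shows "q / sqrt (1 + q\<^sup>2) * (p - q) \<le> sqrt (1 + p\<^sup>2) - sqrt (1 + q\<^sup>2)"
proof -
  define s where "s = sqrt (1 + q\<^sup>2)"
  have s: "s > 0" "s * s = 1 + q\<^sup>2" by (simp_all add: s_def add_pos_nonneg)
  have "1 + p * q \<le> sqrt ((1 + p * q)\<^sup>2)" by simp
  also have "\<dots> \<le> sqrt ((1 + p\<^sup>2) * (1 + q\<^sup>2))"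
  proof (rule real_sqrt_le_mono)
    have "0 \<le> (p - q)\<^sup>2" by simp
    then show "(1 + p * q)\<^sup>2 \<le> (1 + p\<^sup>2) * (1 + q\<^sup>2)" by (simp add: power2_eq_square algebra_simps)
  qed
  also have "\<dots> = sqrt (1 + p\<^sup>2) * s" by (simp add: real_sqrt_mult s_def)
  finally have "q * (p - q) \<le> (sqrt (1 + p\<^sup>2) - s) * s"
    using s by (simp add: algebra_simps power2_eq_square)
  then have "q * (p - q) / s \<le> sqrt (1 + p\<^sup>2) - s" using s by (simp add: pos_divide_le_eq)
  then show ?thesis by (simp add: s_def)
qed

lemma DERIV_sqrt_quotient:
  assumes "(f has_real_derivative f') (at x)"
  shows "((\<lambda>y. f y / sqrt (1 + (f y)\<^sup>2)) has_real_derivative f' / sqrt (1 + (f x)\<^sup>2) ^ 3) (at x)"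
proof -
  have p: "1 + (f x)\<^sup>2 > 0" by (simp add: add_pos_nonneg)
  define s where "s = sqrt (1 + (f x)\<^sup>2)"
  have s: "s > 0" "(f x)\<^sup>2 = s * s - 1" using p by (auto simp: s_def)
  have e: "((\<lambda>y. sqrt (1 + (f y)\<^sup>2)) has_real_derivative f x * f' / s) (at x)"
  proof -
    have "((\<lambda>y. 1 + (f y)\<^sup>2) has_real_derivative 2 * f x * f') (at x)"
      by (rule derivative_eq_intros assms refl | simp)+
    from DERIV_chain2[where f=sqrt and g="\<lambda>y. 1 + (f y)\<^sup>2", OF DERIV_real_sqrt[OF p] this] show ?thesis
      by (rule DERIV_cong) (simp add: s_def inverse_eq_divide)
  qed
  have "sqrt (1 + (f x)\<^sup>2) \<noteq> 0" using s(1) by (simp add: s_def)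
  from DERIV_divide[OF assms e this] have "((\<lambda>y. f y / sqrt (1 + (f y)\<^sup>2)) has_real_derivative (f' * s - f x * (f x * f' / s)) / (s * s)) (at x)"
    by (simp only: s_def)
  moreover have "(f' * s - f x * (f x * f' / s)) / (s * s) = f' / s ^ 3"
  proof -
    have "f x * (f x * f' / s) = (f x)\<^sup>2 * f' / s" by (simp add: power2_eq_square)
    also have "\<dots> = s * f' - f' / s" unfolding s(2) using s(1) by (simp add: field_simps)
    finally show ?thesis using s(1) by (simp add: field_simps power3_eq_cube)
  qed
  ultimately show ?thesis by (simp add: s_def)
qed

section \<open>The flow\<close>

lemma one_plus_square_pos [simp]: "1 + (p::real)\<^sup>2 > 0"
  by (simp add: add_pos_nonneg)

lemma one_plus_square_neq_0 [simp]: "1 + (p::real)\<^sup>2 \<noteq> 0"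
  by (metis less_irrefl one_plus_square_pos)

locale graph_flow =
  fixes \<sigma> :: "real \<Rightarrow> real" and \<mu> \<gamma> :: real and u0 :: "real \<Rightarrow> real" and \<alpha>0 :: real
    and u :: "real \<Rightarrow> real \<Rightarrow> real" and \<alpha> :: "real \<Rightarrow> real"
  assumes analytic: "real_analytic \<sigma>" and sigma_pos: "\<And>x. \<sigma> x > 0"
    and mu: "\<mu> > 0" and gamma: "\<gamma> > 0"
    and solution: "global_classical_solution \<sigma> \<mu> \<gamma> u0 \<alpha>0 u \<alpha>"
begin

text \<open>The signed curvature of the graph, which is the \<open>x\<close>-derivative of
  \<open>u_x / sqrt (1 + u_x\<^sup>2)\<close>. The closed form makes its joint continuity
  evident.\<close>

definition curv :: "real \<Rightarrow> real \<Rightarrow> real" where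
  "curv x t = dx (dx u) x t / sqrt (1 + (dx u x t)\<^sup>2) ^ 3"

definition len :: "real \<Rightarrow> real" where
  "len t = integral {0..1} (\<lambda>x. sqrt (1 + (dx u x t)\<^sup>2))"

definition dissipation :: "real \<Rightarrow> real" where
  "dissipation t = \<gamma> * (deriv \<sigma> (\<alpha> t))\<^sup>2 * (len t)\<^sup>2
     + \<mu> * (\<sigma> (\<alpha> t))\<^sup>2 * integral {0..1} (\<lambda>x. sqrt (1 + (dx u x t)\<^sup>2) * (curv x t)\<^sup>2)"

section \<open>Regularity, periodicity and the pointwise equations\<close>

lemma periodic: "t > 0 \<Longrightarrow> u (x + 1) t = u x t"
  using solution by (simp add: global_classical_solution_def)

lemma DERIV_u_x: "t > 0 \<Longrightarrow> ((\<lambda>y. u y t) has_real_derivative dx u x t) (at x)"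
  using solution by (simp add: global_classical_solution_def dx_def DERIV_deriv_iff_real_differentiable)

lemma DERIV_u_xx: "t > 0 \<Longrightarrow> ((\<lambda>y. dx u y t) has_real_derivative dx (dx u) x t) (at x)"
  using solution by (simp add: global_classical_solution_def dx_def[of "dx u"] DERIV_deriv_iff_real_differentiable)

lemma DERIV_u_t: "t > 0 \<Longrightarrow> (u x has_real_derivative dt u x t) (at t)"
  using solution by (simp add: global_classical_solution_def dt_def DERIV_deriv_iff_real_differentiable)

lemma continuous_joint:
  "continuous_on (UNIV \<times> {0<..}) (\<lambda>(x, t). dt u x t)"
  "continuous_on (UNIV \<times> {0<..}) (\<lambda>(x, t). dx u x t)"
  "continuous_on (UNIV \<times> {0<..}) (\<lambda>(x, t). dx (dx u) x t)"
  using solution by (simp_all add: global_classical_solution_def)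

lemma continuous_joint_curv: "continuous_on (UNIV \<times> {0<..}) (\<lambda>(x, t). curv x t)"
  using continuous_joint(2,3) unfolding curv_def
  by (auto simp: split_beta intro!: continuous_intros one_plus_square_neq_0)

lemma continuous_slice:
  fixes f :: "real \<Rightarrow> real \<Rightarrow> real"
  assumes "continuous_on (UNIV \<times> {0<..}) (\<lambda>(x, t). f x t)" "t > 0"
  shows "continuous_on S (\<lambda>x. f x t)"
proof -
  have "continuous_on S (\<lambda>x. case (x, t) of (x, t) \<Rightarrow> f x t)"
    by (rule continuous_on_compose2[OF assms(1)]) (use assms(2) in \<open>auto intro!: continuous_intros\<close>)
  then show ?thesis by simp
qed

text \<open>Time comes first here, as parameter of the integrals and in the compactness argument
  over \<open>{0..1}\<close>.\<close>

lemma continuous_swap: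
  fixes f :: "real \<Rightarrow> real \<Rightarrow> real"
  assumes "continuous_on (UNIV \<times> {0<..}) (\<lambda>(x, t). f x t)"
  shows "continuous_on ({0<..} \<times> S) (\<lambda>p. f (snd p) (fst p))"
proof -
  have "continuous_on ({0<..} \<times> S) (\<lambda>p. case (snd p, fst p) of (x, t) \<Rightarrow> f x t)"
    by (rule continuous_on_compose2[OF assms]) (auto intro!: continuous_intros)
  then show ?thesis by simp
qed

lemmas continuous_u_t = continuous_slice[OF continuous_joint(1)]
  and continuous_u_x = continuous_slice[OF continuous_joint(2)]
  and continuous_u_xx = continuous_slice[OF continuous_joint(3)]
  and continuous_curv = continuous_slice[OF continuous_joint_curv]

lemma continuous_u: "t > 0 \<Longrightarrow> continuous_on S (\<lambda>x. u x t)"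
  by (rule continuous_at_imp_continuous_on) (use DERIV_u_x in \<open>auto intro: DERIV_isCont\<close>)

lemma periodic_u_x: assumes "t > 0" shows "dx u (x + 1) t = dx u x t"
proof -
  have "((\<lambda>y. u (y + 1) t) has_real_derivative dx u (x + 1) t) (at x)"
    using DERIV_u_x[OF assms, of "x + 1"] by (simp add: DERIV_shift)
  then show ?thesis
    using DERIV_u_x[OF assms, of x] DERIV_unique by (simp add: periodic[OF assms])
qed

lemma DERIV_curv:
  "t > 0 \<Longrightarrow> ((\<lambda>y. dx u y t / sqrt (1 + (dx u y t)\<^sup>2)) has_real_derivative curv x t) (at x)"
  unfolding curv_def by (rule DERIV_sqrt_quotient[OF DERIV_u_xx])

lemma u_t_eq: assumes "t > 0"
  shows "dt u x t = \<mu> * \<sigma> (\<alpha> t) * sqrt (1 + (dx u x t)\<^sup>2) * curv x t"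
proof -
  have "dt u x t / sqrt (1 + (dx u x t)\<^sup>2) = \<mu> * \<sigma> (\<alpha> t) * deriv (\<lambda>y. dx u y t / sqrt (1 + (dx u y t)\<^sup>2)) x"
    using solution assms by (simp add: global_classical_solution_def)
  also have "deriv (\<lambda>y. dx u y t / sqrt (1 + (dx u y t)\<^sup>2)) x = curv x t"
    by (rule DERIV_imp_deriv[OF DERIV_curv[OF assms]])
  finally show ?thesis using one_plus_square_pos[of "dx u x t"]
    by (simp add: divide_eq_eq one_plus_square_neq_0)
qed

lemma DERIV_alpha: assumes "t > 0"
  shows "(\<alpha> has_real_derivative - \<gamma> * deriv \<sigma> (\<alpha> t) * len t) (at t)"
proof -
  obtain D where "\<forall>x\<in>{0<..}. (\<alpha> has_real_derivative D x) (at x)"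
    using solution by (auto simp: global_classical_solution_def C1_differentiable_on_def has_real_derivative_iff_has_vector_derivative)
  then have "(\<alpha> has_real_derivative deriv \<alpha> t) (at t)"
    using assms DERIV_imp_deriv by fastforce
  moreover have "unit_integral (\<lambda>x. sqrt (1 + (dx u x t)\<^sup>2)) = len t"
    unfolding len_def
    by (rule lebesgue_integral_continuous_Ioo(2)) (intro continuous_intros continuous_u_x assms)
  ultimately show ?thesis using solution assms by (simp add: global_classical_solution_def)
qed

section \<open>The time derivative of the length\<close>

lemma curv_by_parts:
  assumes "t > 0" "s > 0"
  shows "integral {0..1} (\<lambda>x. dx u x t / sqrt (1 + (dx u x t)\<^sup>2) * (dx u x s - dx u x t))
    = - integral {0..1} (\<lambda>x. curv x t * (u x s - u x t))"
proof -
  let ?P = "\<lambda>x. dx u x t / sqrt (1 + (dx u x t)\<^sup>2)"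
  let ?I = "integral {0..1} (\<lambda>x. ?P x * (dx u x s - dx u x t))"
  have cP: "continuous_on {0..1} ?P"
    by (intro continuous_intros continuous_u_x assms) (auto simp: one_plus_square_neq_0)
  have "((\<lambda>x. curv x t * (u x s - u x t)) has_integral - ?I) {0..1}"
  proof (rule integration_by_parts_interior[OF bounded_bilinear_mult])
    \<comment> \<open>Periodicity of \<open>u\<close> and \<open>u_x\<close> cancels the boundary
      terms.\<close>
    have "?P 1 = ?P 0" "u 1 s = u 0 s" "u 1 t = u 0 t"
      using periodic_u_x[OF assms(1), of 0] periodic[of _ 0] assms by auto
    then have e: "?P 1 * (u 1 s - u 1 t) - ?P 0 * (u 0 s - u 0 t) - - ?I = ?I" by simp
    show "((\<lambda>x. ?P x * (dx u x s - dx u x t)) has_integral ?P 1 * (u 1 s - u 1 t) - ?P 0 * (u 0 s - u 0 t) - - ?I) {0..1}"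
      unfolding e by (intro integrable_integral integrable_continuous_real continuous_intros cP continuous_u_x assms)
    show "(?P has_vector_derivative curv x t) (at x)" for x
      using DERIV_curv[OF assms(1)] by (simp add: has_real_derivative_iff_has_vector_derivative)
    show "((\<lambda>x. u x s - u x t) has_vector_derivative dx u x s - dx u x t) (at x)" for x
      using DERIV_diff[OF DERIV_u_x[OF assms(2)] DERIV_u_x[OF assms(1)]] by (simp add: has_real_derivative_iff_has_vector_derivative)
  qed (use cP assms in \<open>auto intro!: continuous_intros continuous_u\<close>)
  then show ?thesis by (simp add: integral_unique)
qed

text \<open>The tangent inequality integrated in \<open>x\<close>, followed by integration by parts,
  which moves the \<open>x\<close>-derivative from the increment of \<open>u\<close> to the
  curvature. Exchanging \<open>t\<close> and \<open>s\<close> gives the matching upper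
  bound.\<close>

lemma len_increment_ge:
  assumes "t > 0" "s > 0"
  shows "len s - len t \<ge> - integral {0..1} (\<lambda>x. curv x t * (u x s - u x t))"
proof -
  have c: "continuous_on {0..1} (\<lambda>x. sqrt (1 + (dx u x r)\<^sup>2))" if "r > 0" for r
    by (intro continuous_intros continuous_u_x that)
  have "len s - len t = integral {0..1} (\<lambda>x. sqrt (1 + (dx u x s)\<^sup>2) - sqrt (1 + (dx u x t)\<^sup>2))"
    unfolding len_def
    by (rule integral_diff[symmetric]) (intro integrable_continuous_real c assms)+
  moreover have "integral {0..1} (\<lambda>x. dx u x t / sqrt (1 + (dx u x t)\<^sup>2) * (dx u x s - dx u x t)) \<le> \<dots>"
    by (intro integral_le integrable_continuous_real continuous_intros continuous_u_x c assms sqrt_one_plus_square_tangent)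
       (auto simp: one_plus_square_neq_0)
  ultimately show ?thesis using curv_by_parts[OF assms] by simp
qed

text \<open>The weight does not depend on time: it is the curvature frozen at one time in
  \<open>DERIV_len\<close>, and a fixed difference \<open>u(t) - u(s)\<close> in the final
  estimate.\<close>

lemma DERIV_integral_u:
  assumes "continuous_on {0..1} w" "t > 0"
  shows "((\<lambda>s. integral {0..1} (\<lambda>x. w x * u x s)) has_real_derivative integral {0..1} (\<lambda>x. w x * dt u x t)) (at t)"
proof -
  have "((\<lambda>s. integral (cbox 0 1) (\<lambda>x. w x * u x s)) has_real_derivative integral (cbox 0 1) (\<lambda>x. w x * dt u x t)) (at t within {0<..})"
  proof (rule leibniz_rule_field_derivative)
    show "((\<lambda>s. w x * u x s) has_real_derivative w x * dt u x s) (at s within {0<..})" if "s \<in> {0<..}" for x s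
      using that by (intro DERIV_cmult has_field_derivative_at_within[OF DERIV_u_t]) simp
    show "(\<lambda>x. w x * u x s) integrable_on cbox 0 1" if "s \<in> {0<..}" for s
      using that assms by (auto intro!: integrable_continuous_real continuous_intros continuous_u)
    have "continuous_on ({0<..} \<times> {0..1}) (\<lambda>p. dt u (snd p) (fst p))"
      by (rule continuous_swap[OF continuous_joint(1)])
    moreover have "continuous_on ({0<..} \<times> {0..1}) (\<lambda>p. w (snd p))"
      by (rule continuous_on_compose2[OF assms(1)]) (auto intro!: continuous_intros)
    ultimately show "continuous_on ({0<..} \<times> cbox 0 1) (\<lambda>(s, x). w x * dt u x s)"
      unfolding split_beta box_real by (intro continuous_on_mult)
  qed (use assms in auto)
  then show ?thesis using assms at_within_open[of t "{0<..}"] by simp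
qed

text \<open>Compactness of \<open>{0..1}\<close> makes continuity in time uniform in
  \<open>x\<close>.\<close>

lemma uniformly_close:
  fixes f :: "real \<Rightarrow> real \<Rightarrow> real"
  assumes "continuous_on (UNIV \<times> {0<..}) (\<lambda>(x, t). f x t)" "t > 0" "e > 0"
  shows "\<exists>d>0. \<forall>s. \<bar>s - t\<bar> < d \<longrightarrow> s > 0 \<and> (\<forall>x\<in>{0..1}. \<bar>f x s - f x t\<bar> \<le> e)"
proof -
  have t: "t \<in> {0<..}" using assms(2) by simp
  from continuous_on_prod_compactE[OF continuous_swap[OF assms(1)] compact_Icc[of 0 1] t assms(3)]
  obtain X where X: "t \<in> X" "open X"
      "\<forall>s\<in>X \<inter> {0<..}. \<forall>x\<in>{0..1}. dist (f (snd (s, x)) (fst (s, x))) (f (snd (t, x)) (fst (t, x))) \<le> e"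
    by metis
  have "open (X \<inter> {0<..})" "t \<in> X \<inter> {0<..}" using X t by auto
  then obtain d where d: "d > 0" "ball t d \<subseteq> X \<inter> {0<..}"
    using open_contains_ball by metis
  show ?thesis
  proof (intro exI[of _ d] conjI allI impI ballI)
    fix s :: real assume "\<bar>s - t\<bar> < d"
    then have "s \<in> ball t d" by (simp add: dist_real_def abs_minus_commute)
    then have s: "s \<in> X \<inter> {0<..}" using d(2) by blast
    then show "s > 0" by simp
    show "\<bar>f x s - f x t\<bar> \<le> e" if "x \<in> {0..1}" for x
      using X(3) s that by (simp add: dist_real_def)
  qed (rule d(1))
qed

lemma u_locally_Lipschitz:
  assumes "t > 0"
  shows "\<exists>d>0. \<exists>M>0. \<forall>s. \<bar>s - t\<bar> < d \<longrightarrow> (\<forall>x\<in>{0..1}. \<bar>u x s - u x t\<bar> \<le> M * \<bar>s - t\<bar>)"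
proof -
  obtain d where d: "d > 0" "\<forall>s. \<bar>s - t\<bar> < d \<longrightarrow> s > 0 \<and> (\<forall>x\<in>{0..1}. \<bar>dt u x s - dt u x t\<bar> \<le> 1)"
    using uniformly_close[OF continuous_joint(1) assms zero_less_one] by blast
  have "bounded ((\<lambda>x. dt u x t) ` {0..1})"
    by (intro compact_imp_bounded compact_continuous_image continuous_u_t assms compact_Icc)
  then obtain M where M: "M > 0" "\<And>x. x \<in> {0..1} \<Longrightarrow> \<bar>dt u x t\<bar> \<le> M"
    unfolding bounded_pos by auto
  \<comment> \<open>\<open>M\<close> bounds \<open>u_t\<close> at time \<open>t\<close> and
    \<open>1\<close> bounds its oscillation nearby.\<close>
  have "\<bar>u x s - u x t\<bar> \<le> (M + 1) * \<bar>s - t\<bar>" if s: "\<bar>s - t\<bar> < d" and x: "x \<in> {0..1}" for s x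
  proof -
    have "norm (u x s - u x t) \<le> (M + 1) * norm (s - t)"
    proof (rule field_differentiable_bound[of "ball t d" "u x" "dt u x"])
      fix r assume "r \<in> ball t d"
      then have r: "\<bar>r - t\<bar> < d" by (simp add: dist_real_def abs_minus_commute)
      then have "r > 0" using d(2) by simp
      then show "(u x has_real_derivative dt u x r) (at r within ball t d)"
        by (intro has_field_derivative_at_within[OF DERIV_u_t])
      have "\<bar>dt u x r - dt u x t\<bar> \<le> 1" using d(2) r x by blast
      then show "norm (dt u x r) \<le> M + 1"
        using M(2)[OF x] unfolding real_norm_def by linarith
    qed (use s d(1) in \<open>auto simp: dist_real_def abs_minus_commute\<close>)
    then show ?thesis by simp
  qed
  then show ?thesis using d(1) M(1) by (intro exI[of _ d] exI[of _ "M + 1"] conjI) auto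
qed

text \<open>The mixed derivative \<open>u_xt\<close> need not exist. By convexity of \<open>p \<mapsto> sqrt (1 + p\<^sup>2)\<close>, the
  increments of the length are squeezed between two expressions without it.\<close>

lemma DERIV_len:
  assumes t: "t > 0"
  shows "(len has_real_derivative - integral {0..1} (\<lambda>x. curv x t * dt u x t)) (at t)"
proof -
  let ?I = "integral {0..1} (\<lambda>x. curv x t * dt u x t)"
  define A where "A s = integral {0..1} (\<lambda>x. curv x t * u x s)" for s
  \<comment> \<open>The error of the expected first-order expansion of the length; it remains to
    show that \<open>r\<close> has derivative \<open>0\<close> at \<open>t\<close>.\<close>
  define r where "r s = len s - len t + (A s - A t)" for s
  have dA: "(A has_real_derivative ?I) (at t)"
    unfolding A_def by (rule DERIV_integral_u[OF continuous_curv[OF t] t])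
  have A_diff: "A s - A t = integral {0..1} (\<lambda>x. curv x t * (u x s - u x t))" if "s > 0" for s
    unfolding A_def using that t
    by (subst integral_diff[symmetric])
      (auto intro!: integrable_continuous_real continuous_intros continuous_curv continuous_u simp: algebra_simps)
  have "((\<lambda>h. (r (t + h) - r t) / h) \<longlongrightarrow> 0) (at 0)"
  proof (rule tendstoI)
    fix e :: real assume e: "e > 0"
    obtain d1 M where d1: "d1 > 0" "M > 0" "\<forall>s. \<bar>s - t\<bar> < d1 \<longrightarrow> (\<forall>x\<in>{0..1}. \<bar>u x s - u x t\<bar> \<le> M * \<bar>s - t\<bar>)"
      using u_locally_Lipschitz[OF t] by blast
    \<comment> \<open>With the Lipschitz constant \<open>M\<close> of \<open>u\<close>, this
      tolerance for the curvature bounds the error by \<open>e / 2 * \<bar>h\<bar>\<close>, strictly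
      below \<open>e * \<bar>h\<bar>\<close>.\<close>
    have "e / (2 * M) > 0" using e d1 by simp
    then obtain d2 where d2: "d2 > 0" "\<forall>s. \<bar>s - t\<bar> < d2 \<longrightarrow> s > 0 \<and> (\<forall>x\<in>{0..1}. \<bar>curv x s - curv x t\<bar> \<le> e / (2 * M))"
      using uniformly_close[OF continuous_joint_curv t] by blast
    have ev: "\<bar>(r (t + h) - r t) / h\<bar> < e" if h: "h \<noteq> 0" "\<bar>h\<bar> < min d1 d2" for h
    proof -
      let ?s = "t + h"
      have s: "?s > 0" using d2(2) h by simp
      \<comment> \<open>Using \<open>len_increment_ge\<close> from both times gives
        \<open>0 \<le> r ?s \<le> - ?R\<close>. The integrand is a product of two increments, hence
        \<open>?R\<close> is of smaller order than \<open>h\<close>.\<close>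
      let ?R = "integral {0..1} (\<lambda>x. (curv x ?s - curv x t) * (u x ?s - u x t))"
      have "len t - len ?s \<ge> - integral {0..1} (\<lambda>x. curv x ?s * (u x t - u x ?s))"
        by (rule len_increment_ge[OF s t])
      moreover have "?R = - integral {0..1} (\<lambda>x. curv x ?s * (u x t - u x ?s)) - integral {0..1} (\<lambda>x. curv x t * (u x ?s - u x t))"
        using s t by (subst integral_neg[symmetric], subst integral_diff[symmetric])
          (auto intro!: integrable_continuous_real continuous_intros continuous_curv continuous_u simp: algebra_simps)
      ultimately have "r ?s \<le> - ?R" using A_diff[OF s] by (simp add: r_def)
      moreover have "r ?s \<ge> 0" using len_increment_ge[OF t s] A_diff[OF s] by (simp add: r_def)
      ultimately have "\<bar>r ?s\<bar> \<le> \<bar>?R\<bar>" by linarith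
      also have "\<bar>?R\<bar> = norm ?R" by simp
      also have "\<dots> \<le> integral {0..1::real} (\<lambda>x. e / (2 * M) * (M * \<bar>h\<bar>))"
      proof (rule integral_norm_bound_integral)
        show "norm ((curv x ?s - curv x t) * (u x ?s - u x t)) \<le> e / (2 * M) * (M * \<bar>h\<bar>)" if x: "x \<in> {0..1}" for x
        proof -
          have "\<bar>curv x ?s - curv x t\<bar> \<le> e / (2 * M)" "\<bar>u x ?s - u x t\<bar> \<le> M * \<bar>h\<bar>"
            using d1(3)[rule_format, of ?s x] d2(2)[rule_format, of ?s] h x by auto
          then show ?thesis
            unfolding real_norm_def abs_mult using e d1(2) by (intro mult_mono) auto
        qed
      qed (use s t in \<open>auto intro!: integrable_continuous_real continuous_intros continuous_curv continuous_u\<close>)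
      also have "\<dots> = e / 2 * \<bar>h\<bar>" using d1(2) by simp
      also have "\<dots> < e * \<bar>h\<bar>" using e h by simp
      finally show ?thesis using h by (simp add: r_def abs_divide pos_divide_less_eq)
    qed
    show "\<forall>\<^sub>F h in at 0. dist ((r (t + h) - r t) / h) 0 < e"
      unfolding eventually_at dist_real_def diff_0_right
    proof (intro exI conjI ballI impI)
      show "0 < min d1 d2" using d1(1) d2(1) by simp
      show "\<bar>(r (t + h) - r t) / h\<bar> < e" if "h \<noteq> 0 \<and> \<bar>h\<bar> < min d1 d2" for h
        by (rule ev) (use that in blast)+
    qed
  qed
  then have "(r has_real_derivative 0) (at t)" unfolding DERIV_def .
  from DERIV_add[OF DERIV_diff[OF this dA] DERIV_const[of "len t + A t"]]
  have "((\<lambda>s. r s - A s + (len t + A t)) has_real_derivative 0 - ?I + 0) (at t)" .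
  moreover have "(\<lambda>s. r s - A s + (len t + A t)) = len"
    unfolding r_def by (rule ext) linarith
  ultimately show ?thesis by (simp only: diff_0 add_0_right)
qed

section \<open>Energy dissipation\<close>

lemma DERIV_energy:
  assumes t: "t > 0"
  shows "((\<lambda>t. \<sigma> (\<alpha> t) * len t) has_real_derivative - dissipation t) (at t)"
proof -
  have "((\<lambda>t. \<sigma> (\<alpha> t)) has_real_derivative deriv \<sigma> (\<alpha> t) * (- \<gamma> * deriv \<sigma> (\<alpha> t) * len t)) (at t)"
    by (rule DERIV_chain2[where f=\<sigma> and g=\<alpha>, OF real_analytic_imp_DERIV[OF analytic] DERIV_alpha[OF t]])
  from DERIV_mult[OF this DERIV_len[OF t]]
  have d: "((\<lambda>t. \<sigma> (\<alpha> t) * len t) has_real_derivative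
    deriv \<sigma> (\<alpha> t) * (- \<gamma> * deriv \<sigma> (\<alpha> t) * len t) * len t + - integral {0..1} (\<lambda>x. curv x t * dt u x t) * \<sigma> (\<alpha> t)) (at t)" .
  \<comment> \<open>Inserting the equation for \<open>u_t\<close> turns the pairing with the
    curvature into a weighted integral of its square.\<close>
  have i: "integral {0..1} (\<lambda>x. curv x t * dt u x t)
      = \<mu> * \<sigma> (\<alpha> t) * integral {0..1} (\<lambda>x. sqrt (1 + (dx u x t)\<^sup>2) * (curv x t)\<^sup>2)"
    unfolding integral_mult_right[symmetric]
    by (rule integral_cong) (simp add: u_t_eq[OF t] power2_eq_square)
  show ?thesis
    by (rule DERIV_cong[OF d]) (simp add: i dissipation_def power2_eq_square)
qed

section \<open>Control of the slope\<close>

lemma u_x_zero: assumes "t > 0" shows "\<exists>z\<in>{0..1}. dx u z t = 0"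
proof -
  obtain z where "0 < z" "z < 1" "u 1 t - u 0 t = (1 - 0) * dx u z t"
    using MVT2[of 0 1 "\<lambda>x. u x t" "\<lambda>x. dx u x t"] DERIV_u_x[OF assms] by auto
  moreover have "u 1 t = u 0 t" using periodic[OF assms, of 0] by simp
  ultimately show ?thesis by (intro bexI[of _ z]) auto
qed

text \<open>The slope vanishes somewhere, so its square is at most the integral of
  \<open>u_xx\<^sup>2\<close>, which the norm controls. This supplies the upper bound for
  \<open>sqrt (1 + u_x\<^sup>2)\<close> in the estimate of \<open>u_t\<close>.\<close>

lemma u_x_square_le_1:
  assumes t: "t > 0" and small: "norm_Y (\<lambda>x. u x t, b) < 1" and x: "x \<in> {0..1}"
  shows "(dx u x t)\<^sup>2 \<le> 1"
proof -
  have H2: "(norm_H2 (\<lambda>x. u x t))\<^sup>2 = integral {0..1} (\<lambda>x. (dx u x t)\<^sup>2) + integral {0..1} (\<lambda>x. (dx (dx u) x t)\<^sup>2)"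
    by (rule norm_H2_C2[OF continuous_u[OF t] DERIV_u_x[OF t] continuous_u_x[OF t] DERIV_u_xx[OF t] continuous_u_xx[OF t] refl])
  have "integral {0..1} (\<lambda>x. (dx u x t)\<^sup>2) \<ge> 0"
    by (intro integral_nonneg integrable_continuous_real continuous_intros continuous_u_x t) simp
  moreover have "(norm_H2 (\<lambda>x. u x t))\<^sup>2 + b\<^sup>2 < 1"
    using small by (simp add: norm_Y_def)
  ultimately have "integral {0..1} (\<lambda>x. (dx (dx u) x t)\<^sup>2) \<le> 1"
    using H2 zero_le_power2[of b] by linarith
  moreover obtain z where "z \<in> {0..1}" "dx u z t = 0" using u_x_zero[OF t] by blast
  then have "(dx u x t)\<^sup>2 \<le> integral {0..1} (\<lambda>x. (dx (dx u) x t)\<^sup>2)"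
    by (rule square_le_integral_deriv_square[OF DERIV_u_xx[OF t] continuous_u_xx[OF t] _ _ x])
  ultimately show ?thesis by linarith
qed

section \<open>Energy and gradient in terms of classical derivatives\<close>

lemma wderiv_u:
  assumes t: "t > 0"
  shows "set_borel_measurable lebesgue {0<..<1} (wderiv (\<lambda>x. u x t))"
    "AE x\<in>{0<..<1} in lebesgue. wderiv (\<lambda>x. u x t) x = dx u x t"
proof -
  have m: "set_borel_measurable lebesgue {0<..<1} (\<lambda>x. u x t)"
    using continuous_in_L2[OF continuous_u[OF t]] by (simp add: L2_def)
  show "set_borel_measurable lebesgue {0<..<1} (wderiv (\<lambda>x. u x t))"
    by (rule wderiv_C1(1)[OF continuous_u[OF t] DERIV_u_x[OF t] continuous_u_x[OF t] m AE_I2]) simp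
  show "AE x\<in>{0<..<1} in lebesgue. wderiv (\<lambda>x. u x t) x = dx u x t"
    by (rule wderiv_C1(2)[OF continuous_u[OF t] DERIV_u_x[OF t] continuous_u_x[OF t] m AE_I2]) simp
qed

lemma length_wderiv: assumes t: "t > 0"
  shows "unit_integral (\<lambda>x. sqrt (1 + (wderiv (\<lambda>x. u x t) x)\<^sup>2)) = len t"
  unfolding len_def
  by (rule lebesgue_integral_comp_AE_eq[OF wderiv_u(1)[OF t] continuous_u_x[OF t] wderiv_u(2)[OF t],
        where F="\<lambda>p. sqrt (1 + p\<^sup>2)"]) (intro continuous_intros)

lemma energy_eq: "t > 0 \<Longrightarrow> energy \<sigma> (\<lambda>x. u x t, \<alpha> t) = \<sigma> (\<alpha> t) * len t"
  by (simp add: energy_def length_wderiv)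

text \<open>Up to an additive constant, the function component is
  \<open>\<sigma> (\<alpha> t)\<close> times a primitive of
  \<open>u_x / sqrt (1 + u_x\<^sup>2)\<close>, so its first two derivatives are multiples of that
  quotient and of the curvature.\<close>

lemma norm_energy_gradient:
  assumes t: "t > 0"
  shows "(norm_Y (energy_gradient \<sigma> (\<lambda>x. u x t, \<alpha> t)))\<^sup>2
    = integral {0..1} (\<lambda>x. (\<sigma> (\<alpha> t) * (dx u x t / sqrt (1 + (dx u x t)\<^sup>2)))\<^sup>2)
    + integral {0..1} (\<lambda>x. (\<sigma> (\<alpha> t) * curv x t)\<^sup>2) + (deriv \<sigma> (\<alpha> t) * len t)\<^sup>2"
proof -
  define w where "w = wderiv (\<lambda>x. u x t)"
  define P where "P x = dx u x t / sqrt (1 + (dx u x t)\<^sup>2)" for x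
  define G where "G x = (LINT y:{0<..<x}|lebesgue. w y / sqrt (1 + (w y)\<^sup>2))" for x
  define a where "a = \<sigma> (\<alpha> t)"
  note w = wderiv_u[OF t, folded w_def]
  have cP: "continuous_on S P" for S
    unfolding P_def by (intro continuous_intros continuous_u_x t) simp
  have G: "G x = integral {0..x} P" if x: "x \<in> {0<..<1}" for x
    unfolding G_def P_def
  proof (rule lebesgue_integral_comp_AE_eq[where F="\<lambda>p. p / sqrt (1 + p\<^sup>2)"])
    show "set_borel_measurable lebesgue {0<..<x} w"
      by (rule set_borel_measurable_subset[OF w(1)]) (use x in auto)
    show "continuous_on {0..x} (\<lambda>x. dx u x t)" by (rule continuous_u_x[OF t])
    show "AE y\<in>{0<..<x} in lebesgue. w y = dx u y t"
      using w(2) by eventually_elim (use x in auto)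
    show "continuous_on UNIV (\<lambda>p::real. p / sqrt (1 + p\<^sup>2))"
      by (intro continuous_intros) simp
  qed
  have H2: "(norm_H2 (\<lambda>x. a * (G x - unit_integral G)))\<^sup>2 = integral {0..1} (\<lambda>x. (a * P x)\<^sup>2) + integral {0..1} (\<lambda>x. (a * curv x t)\<^sup>2)"
  proof (rule norm_H2_C2)
    \<comment> \<open>The mean value \<open>unit_integral G\<close> can stay unevaluated, as
      \<open>norm_H2\<close> sees only derivatives.\<close>
    show "continuous_on {0..1} (\<lambda>x. a * (integral {0..x} P - unit_integral G))"
      by (intro continuous_intros indefinite_integral_continuous_1 integrable_continuous_real cP)
    show "((\<lambda>x. a * (integral {0..x} P - unit_integral G)) has_real_derivative a * P x) (at x)" if x: "x \<in> {0<..<1}" for x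
    proof -
      have "((\<lambda>x. integral {0..x} P) has_real_derivative P x) (at x within {0..1})"
        by (rule integral_has_real_derivative[OF cP]) (use x in auto)
      then have "((\<lambda>x. integral {0..x} P) has_real_derivative P x) (at x)"
        using x by (simp add: at_within_Icc_at)
      from DERIV_cmult[OF DERIV_diff[OF this DERIV_const], of a "unit_integral G"]
      show ?thesis by simp
    qed
    show "continuous_on {0..1} (\<lambda>x. a * P x)" by (intro continuous_intros cP)
    show "((\<lambda>x. a * P x) has_real_derivative a * curv x t) (at x)" for x
      unfolding P_def by (rule DERIV_cmult[OF DERIV_curv[OF t]])
    show "continuous_on {0..1} (\<lambda>x. a * curv x t)" by (intro continuous_intros continuous_curv t)
    show "a * (G x - unit_integral G) = a * (integral {0..x} P - unit_integral G)" if "x \<in> {0<..<1}" for x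
      by (simp add: G[OF that])
  qed
  have "energy_gradient \<sigma> (\<lambda>x. u x t, \<alpha> t) = (\<lambda>x. a * (G x - unit_integral G), deriv \<sigma> (\<alpha> t) * len t)"
    unfolding energy_gradient_def Let_def prod.case length_wderiv[OF t] a_def G_def w_def ..
  moreover have "(norm_H2 (\<lambda>x. a * (G x - unit_integral G)))\<^sup>2 + (deriv \<sigma> (\<alpha> t) * len t)\<^sup>2 \<ge> 0" by simp
  ultimately show ?thesis
    unfolding norm_Y_def by (simp only: prod.case real_sqrt_pow2 H2) (simp only: a_def P_def)
qed

text \<open>The first-derivative part of the norm is at most the second-derivative part
  \<open>K\<close>, because \<open>P\<close> vanishes somewhere; and
  \<open>K \<le> a\<^sup>2 * K'\<close>, because \<open>sqrt (1 + u_x\<^sup>2) \<ge> 1\<close>.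
  Counting \<open>K\<close> twice is the origin of \<open>\<mu> / 2\<close>.\<close>

lemma gradient_le_dissipation:
  assumes t: "t > 0"
  shows "min \<gamma> (\<mu> / 2) * (norm_Y (energy_gradient \<sigma> (\<lambda>x. u x t, \<alpha> t)))\<^sup>2 \<le> dissipation t"
proof -
  let ?m = "min \<gamma> (\<mu> / 2)"
  define P where "P x = dx u x t / sqrt (1 + (dx u x t)\<^sup>2)" for x
  define a where "a = \<sigma> (\<alpha> t)"
  define K where "K = integral {0..1} (\<lambda>x. (a * curv x t)\<^sup>2)"
  define K' where "K' = integral {0..1} (\<lambda>x. sqrt (1 + (dx u x t)\<^sup>2) * (curv x t)\<^sup>2)"
  have m: "?m \<ge> 0" "?m \<le> \<gamma>" "?m * 2 \<le> \<mu>" using mu gamma by auto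
  have cP: "continuous_on S P" for S
    unfolding P_def by (intro continuous_intros continuous_u_x t) simp
  obtain z where z: "z \<in> {0..1}" "dx u z t = 0" using u_x_zero[OF t] by blast
  have "(a * P x)\<^sup>2 \<le> K" if x: "x \<in> {0..1}" for x
    unfolding K_def
  proof (rule square_le_integral_deriv_square[OF _ _ z(1) _ x])
    show "((\<lambda>x. a * P x) has_real_derivative a * curv x t) (at x)" for x
      unfolding P_def by (rule DERIV_cmult[OF DERIV_curv[OF t]])
    show "continuous_on {0..1} (\<lambda>x. a * curv x t)" by (intro continuous_intros continuous_curv t)
    show "a * P z = 0" using z by (simp add: P_def)
  qed
  then have "integral {0..1} (\<lambda>x. (a * P x)\<^sup>2) \<le> integral {0..1::real} (\<lambda>x. K)"
    by (intro integral_le integrable_continuous_real continuous_intros cP) auto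
  then have PK: "integral {0..1} (\<lambda>x. (a * P x)\<^sup>2) \<le> K" by simp
  have "K = a\<^sup>2 * integral {0..1} (\<lambda>x. (curv x t)\<^sup>2)"
    unfolding K_def power_mult_distrib by (rule integral_mult_right)
  also have "\<dots> \<le> a\<^sup>2 * K'"
    unfolding K'_def
  proof (intro mult_left_mono integral_le integrable_continuous_real continuous_intros continuous_curv continuous_u_x t)
    show "(curv x t)\<^sup>2 \<le> sqrt (1 + (dx u x t)\<^sup>2) * (curv x t)\<^sup>2" for x
      using mult_right_mono[of 1 "sqrt (1 + (dx u x t)\<^sup>2)" "(curv x t)\<^sup>2"] by simp
  qed simp
  finally have KK: "K \<le> a\<^sup>2 * K'" .
  have K0: "0 \<le> a\<^sup>2 * K'"
    unfolding K'_def
    by (intro mult_nonneg_nonneg integral_nonneg integrable_continuous_real continuous_intros continuous_curv continuous_u_x t) auto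
  have "?m * (norm_Y (energy_gradient \<sigma> (\<lambda>x. u x t, \<alpha> t)))\<^sup>2 \<le> ?m * (2 * (a\<^sup>2 * K') + (deriv \<sigma> (\<alpha> t) * len t)\<^sup>2)"
    using PK KK unfolding norm_energy_gradient[OF t] P_def K_def a_def
    by (intro mult_left_mono m(1)) linarith
  also have "\<dots> = (?m * 2) * (a\<^sup>2 * K') + ?m * (deriv \<sigma> (\<alpha> t) * len t)\<^sup>2" by (simp only: distrib_left mult.assoc)
  also have "\<dots> \<le> \<mu> * (a\<^sup>2 * K') + \<gamma> * (deriv \<sigma> (\<alpha> t) * len t)\<^sup>2"
    by (intro add_mono mult_right_mono m K0) simp
  also have "\<dots> = dissipation t"
    unfolding dissipation_def a_def K'_def power_mult_distrib by (simp only: mult.assoc add.commute)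
  finally show ?thesis .
qed

section \<open>Velocities bounded by the dissipation\<close>

lemma dissipation_nonneg: assumes t: "t > 0" shows "dissipation t \<ge> 0"
  using gradient_le_dissipation[OF t] mu gamma
  by (meson min_less_iff_conj half_gt_zero less_imp_le mult_nonneg_nonneg order_trans zero_le_power2)

text \<open>The square of \<open>\<alpha>_t\<close> is \<open>\<gamma>\<close> times the first
  summand of the dissipation. The larger constant is shared with the bound for
  \<open>u_t\<close>.\<close>

lemma alpha_t_le:
  assumes t: "t > 0"
  shows "\<bar>- \<gamma> * deriv \<sigma> (\<alpha> t) * len t\<bar> \<le> sqrt (\<gamma> + 2 * \<mu>) * sqrt (dissipation t)"
proof -
  have K: "0 \<le> \<mu> * (\<sigma> (\<alpha> t))\<^sup>2 * integral {0..1} (\<lambda>x. sqrt (1 + (dx u x t)\<^sup>2) * (curv x t)\<^sup>2)"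
    using mu
    by (intro mult_nonneg_nonneg integral_nonneg integrable_continuous_real continuous_intros continuous_curv continuous_u_x t) auto
  have "(- \<gamma> * deriv \<sigma> (\<alpha> t) * len t)\<^sup>2 = \<gamma> * (\<gamma> * (deriv \<sigma> (\<alpha> t))\<^sup>2 * (len t)\<^sup>2)"
    by (simp add: power2_eq_square)
  also have "\<dots> \<le> \<gamma> * dissipation t"
    using gamma K by (intro mult_left_mono) (auto simp: dissipation_def)
  also have "\<dots> \<le> (\<gamma> + 2 * \<mu>) * dissipation t"
    using mu dissipation_nonneg[OF t] by (intro mult_right_mono) auto
  finally show ?thesis
    by (metis real_sqrt_abs real_sqrt_le_mono real_sqrt_mult)
qed

text \<open>By the equation, \<open>u_t\<^sup>2\<close> carries the factor
  \<open>1 + u_x\<^sup>2\<close>, while the dissipation has only its square root; the surplus root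
  is bounded by \<open>2\<close>.\<close>

lemma u_t_square_le:
  assumes t: "t > 0" and small: "norm_Y (\<lambda>x. u x t, b) < 1"
  shows "integral {0..1} (\<lambda>x. (dt u x t)\<^sup>2) \<le> (\<gamma> + 2 * \<mu>) * dissipation t"
proof -
  let ?K = "integral {0..1} (\<lambda>x. sqrt (1 + (dx u x t)\<^sup>2) * (curv x t)\<^sup>2)"
  have "integral {0..1} (\<lambda>x. (dt u x t)\<^sup>2)
      \<le> integral {0..1} (\<lambda>x. 2 * \<mu> * (\<mu> * (\<sigma> (\<alpha> t))\<^sup>2) * (sqrt (1 + (dx u x t)\<^sup>2) * (curv x t)\<^sup>2))"
  proof (intro integral_le integrable_continuous_real continuous_intros continuous_curv continuous_u_x continuous_u_t t)
    fix x :: real assume x: "x \<in> {0..1}"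
    define s where "s = sqrt (1 + (dx u x t)\<^sup>2)"
    \<comment> \<open>The radicand is at most \<open>2\<close>, hence at most \<open>4\<close>; the
      rounder bound avoids \<open>sqrt 2\<close>.\<close>
    have "s \<le> sqrt (2\<^sup>2)" unfolding s_def
      using u_x_square_le_1[OF t small x] by (intro real_sqrt_le_mono) simp
    then have s: "0 \<le> s" "s \<le> 2" by (auto simp: s_def)
    have "(dt u x t)\<^sup>2 = \<mu> * (\<mu> * (\<sigma> (\<alpha> t))\<^sup>2) * (s * (curv x t)\<^sup>2) * s"
      unfolding u_t_eq[OF t] s_def[symmetric] by (simp add: power2_eq_square)
    also have "\<dots> \<le> \<mu> * (\<mu> * (\<sigma> (\<alpha> t))\<^sup>2) * (s * (curv x t)\<^sup>2) * 2"
      using mu s by (intro mult_left_mono mult_nonneg_nonneg) auto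
    finally show "(dt u x t)\<^sup>2 \<le> 2 * \<mu> * (\<mu> * (\<sigma> (\<alpha> t))\<^sup>2) * (sqrt (1 + (dx u x t)\<^sup>2) * (curv x t)\<^sup>2)"
      by (simp add: s_def mult_ac)
  qed
  also have "\<dots> = 2 * \<mu> * (\<mu> * (\<sigma> (\<alpha> t))\<^sup>2) * ?K" by (rule integral_mult_right)
  also have "\<dots> \<le> 2 * \<mu> * dissipation t"
    using mu gamma unfolding dissipation_def mult.assoc by (intro mult_left_mono) auto
  also have "\<dots> \<le> (\<gamma> + 2 * \<mu>) * dissipation t"
    using gamma dissipation_nonneg[OF t] by (intro mult_right_mono) auto
  finally show ?thesis .
qed

text \<open>Pairing with a fixed \<open>w\<close> reduces the motion in \<open>L2\<close> to a
  scalar function, to which \<open>abs_increment_le\<close> applies with the \<open>L2\<close> norm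
  of \<open>w\<close> as an additional factor.\<close>

lemma pairing_u_t_le:
  assumes w: "continuous_on {0..1} w" and t: "t > 0" and small: "norm_Y (\<lambda>x. u x t, b) < 1"
  shows "\<bar>integral {0..1} (\<lambda>x. w x * dt u x t)\<bar>
    \<le> sqrt (integral {0..1} (\<lambda>x. (w x)\<^sup>2)) * sqrt (\<gamma> + 2 * \<mu>) * sqrt (dissipation t)"
proof -
  have "(integral {0..1} (\<lambda>x. w x * dt u x t))\<^sup>2 \<le> integral {0..1} (\<lambda>x. (w x)\<^sup>2) * integral {0..1} (\<lambda>x. (dt u x t)\<^sup>2)"
    by (rule integral_Cauchy_Schwarz[OF w continuous_u_t[OF t]])
  also have "\<dots> \<le> integral {0..1} (\<lambda>x. (w x)\<^sup>2) * ((\<gamma> + 2 * \<mu>) * dissipation t)"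
    by (intro mult_left_mono u_t_square_le[OF t small] integral_nonneg integrable_continuous_real continuous_intros w) simp
  finally show ?thesis
    by (metis real_sqrt_abs real_sqrt_le_mono real_sqrt_mult mult.assoc)
qed

section \<open>The two estimates along the flow\<close>

lemma norm_L2_diff:
  assumes "t > 0" "s > 0"
  shows "(norm_L2 (\<lambda>x. u x t - u x s))\<^sup>2 = integral {0..1} (\<lambda>x. (u x t - u x s)\<^sup>2)"
proof -
  have c: "continuous_on {0..1} (\<lambda>x. (u x t - u x s)\<^sup>2)" by (intro continuous_intros continuous_u assms)
  have "integral {0..1} (\<lambda>x. (u x t - u x s)\<^sup>2) \<ge> 0"
    by (intro integral_nonneg integrable_continuous_real c) simp
  then show ?thesis unfolding norm_L2_def lebesgue_integral_continuous_Ioo(2)[OF c] by simp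
qed

text \<open>The constant collects \<open>sqrt (\<gamma> + 2 * \<mu>)\<close> from the velocity
  bounds, \<open>sqrt (min \<gamma> (\<mu> / 2)) * C\<close> from the Lojasiewicz inequality
  rewritten for the dissipation, and \<open>\<theta>\<close> from differentiating the power.\<close>

theorem lojasiewicz_estimate:
  fixes E0 \<theta> C b :: real
  assumes theta: "0 < \<theta>" "\<theta> < 1" and C: "C > 0"
    and small: "\<And>t. t > 0 \<Longrightarrow> norm_Y (\<lambda>x. u x t, \<alpha> t - b) < 1"
    and loj: "\<And>t. t > 0 \<Longrightarrow> norm_Y (energy_gradient \<sigma> (\<lambda>x. u x t, \<alpha> t))
      \<ge> C * \<bar>energy \<sigma> (\<lambda>x. u x t, \<alpha> t) - E0\<bar> powr (1 - \<theta>)"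
    and ts: "0 < t" "t < s"
  defines "K \<equiv> sqrt (\<gamma> + 2 * \<mu>) / (sqrt (min \<gamma> (\<mu> / 2)) * C * \<theta>)"
  shows "\<bar>\<alpha> t - \<alpha> s\<bar> \<le> K * \<bar>energy \<sigma> (\<lambda>x. u x t, \<alpha> t) - E0\<bar> powr \<theta>"
    "norm_L2 (\<lambda>x. u x t - u x s) \<le> K * \<bar>energy \<sigma> (\<lambda>x. u x t, \<alpha> t) - E0\<bar> powr \<theta>"
proof -
  let ?m = "min \<gamma> (\<mu> / 2)"
  let ?H = "\<lambda>t. \<sigma> (\<alpha> t) * len t - E0"
  have m: "?m > 0" using mu gamma by simp
  \<comment> \<open>The lower bound \<open>- E0\<close> holds since the energy is
    nonnegative.\<close>
  interpret F: lojasiewicz_flow ?H dissipation "sqrt ?m * C" \<theta> "- E0"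
  proof
    show "sqrt ?m * C > 0" using m C by simp
    fix t :: real assume t: "t > 0"
    show "(?H has_real_derivative - dissipation t) (at t)"
      using DERIV_diff[OF DERIV_energy[OF t] DERIV_const[of E0]] by simp
    show "dissipation t \<ge> 0" by (rule dissipation_nonneg[OF t])
    have "sqrt ?m * (C * \<bar>?H t\<bar> powr (1 - \<theta>)) \<le> sqrt ?m * norm_Y (energy_gradient \<sigma> (\<lambda>x. u x t, \<alpha> t))"
      using loj[OF t] m by (intro mult_left_mono) (simp_all add: energy_eq[OF t])
    also have "\<dots> \<le> sqrt (?m * (norm_Y (energy_gradient \<sigma> (\<lambda>x. u x t, \<alpha> t)))\<^sup>2)"
      using m by (simp add: real_sqrt_mult mult_left_mono)
    also have "\<dots> \<le> sqrt (dissipation t)"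
      by (rule real_sqrt_le_mono[OF gradient_le_dissipation[OF t]])
    finally show "sqrt (dissipation t) \<ge> sqrt ?m * C * \<bar>?H t\<bar> powr (1 - \<theta>)" by (simp only: mult.assoc)
    have "len t \<ge> 0" unfolding len_def
      by (intro integral_nonneg integrable_continuous_real continuous_intros continuous_u_x t) simp
    then show "?H t \<ge> - E0" using sigma_pos[of "\<alpha> t"] by simp
  qed (use theta in auto)
  let ?R = "\<bar>energy \<sigma> (\<lambda>x. u x t, \<alpha> t) - E0\<bar> powr \<theta>"
  have s: "s > 0" using ts by simp
  show "\<bar>\<alpha> t - \<alpha> s\<bar> \<le> K * ?R"
    using F.abs_increment_le[OF DERIV_alpha alpha_t_le _ ts(1) less_imp_le[OF ts(2)]] mu gamma
    by (simp add: K_def energy_eq[OF ts(1)])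
  \<comment> \<open>Both times are frozen in this weight. The pairing of \<open>w\<close> with
    \<open>u\<close> then changes between \<open>s\<close> and \<open>t\<close> by exactly
    \<open>N\<^sup>2\<close>, and one factor \<open>N\<close> cancels against the bound.\<close>
  define w where "w x = u x t - u x s" for x
  define N where "N = norm_L2 w"
  have w: "continuous_on {0..1} w"
    unfolding w_def by (intro continuous_intros continuous_u ts(1) s)
  have N2: "N\<^sup>2 = integral {0..1} (\<lambda>x. (w x)\<^sup>2)"
    unfolding N_def w_def by (rule norm_L2_diff[OF ts(1) s])
  have N0: "N \<ge> 0" unfolding N_def norm_L2_def
    by (intro real_sqrt_ge_zero) (simp add: lebesgue_integral_continuous_Ioo(2) continuous_intros w integral_nonneg integrable_continuous_real)
  have N: "sqrt (integral {0..1} (\<lambda>x. (w x)\<^sup>2)) = N" using N2 N0 by (metis real_sqrt_unique)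
  have "\<bar>integral {0..1} (\<lambda>x. w x * u x t) - integral {0..1} (\<lambda>x. w x * u x s)\<bar>
      \<le> N * sqrt (\<gamma> + 2 * \<mu>) / (sqrt ?m * C * \<theta>) * \<bar>?H t\<bar> powr \<theta>"
    by (rule F.abs_increment_le[OF DERIV_integral_u[OF w] pairing_u_t_le[OF w _ small, unfolded N] _ ts(1) less_imp_le[OF ts(2)]])
       (use N0 mu gamma in auto)
  moreover have "integral {0..1} (\<lambda>x. w x * u x t) - integral {0..1} (\<lambda>x. w x * u x s) = N\<^sup>2"
    unfolding N2
    by (subst integral_diff[symmetric])
      (use w ts(1) s in \<open>auto intro!: integrable_continuous_real continuous_intros continuous_u integral_cong simp: w_def power2_eq_square algebra_simps\<close>)
  ultimately have "N * N \<le> N * (K * ?R)"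
    by (simp add: K_def energy_eq[OF ts(1)] power2_eq_square)
  moreover have "K * ?R \<ge> 0" using mu gamma C theta by (simp add: K_def)
  ultimately have "N \<le> K * ?R" using N0 by (cases "N = 0") auto
  then show "norm_L2 (\<lambda>x. u x t - u x s) \<le> K * ?R" by (simp add: N_def w_def[abs_def])
qed

end

text \<open>That the constant depends only on the listed parameters is expressed by quantifying it
  first, as a function of them; \<open>\<sigma>\<close> is fixed throughout.\<close>

theorem theorem3p2:
  fixes \<sigma> :: "real \<Rightarrow> real" and c0 :: real
  assumes "real_analytic \<sigma>"
    and "c0 > 0" and "\<forall>x. \<sigma> x \<ge> c0"
  shows "\<exists>C :: real \<Rightarrow> real \<Rightarrow> real \<Rightarrow> real \<Rightarrow> real \<Rightarrow> real \<Rightarrow> real.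
    \<forall>\<mu> \<gamma> \<alpha>bar \<theta> C\<^sub>L\<^sub>S U.
      \<mu> > 0 \<and> \<gamma> > 0 \<and> deriv \<sigma> \<alpha>bar = 0 \<and> 0 < \<theta> \<and> \<theta> \<le> 1/2 \<and> C\<^sub>L\<^sub>S > 0 \<and>
      nbhd_Y (\<lambda>x. 0, \<alpha>bar) U \<and>
      (\<forall>(v, \<beta>)\<in>U. norm_Y (energy_gradient \<sigma> (v, \<beta>))
          \<ge> C\<^sub>L\<^sub>S * \<bar>energy \<sigma> (v, \<beta>) - energy \<sigma> (\<lambda>x. 0, \<alpha>bar)\<bar> powr (1 - \<theta>))
      \<longrightarrow> (\<exists>V. nbhd_Y (\<lambda>x. 0, \<alpha>bar) V \<and>
        (\<forall>u0 \<alpha>0 u \<alpha>.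
          (\<forall>x. u0 (x + 1) = u0 x) \<and> u0 \<in> H_per_ave 2 \<and>
          global_classical_solution \<sigma> \<mu> \<gamma> u0 \<alpha>0 u \<alpha> \<and>
          (\<forall>t>0. (\<lambda>x. u x t, \<alpha> t) \<in> V)
          \<longrightarrow> C \<mu> \<gamma> \<alpha>0 (norm_H2 u0) \<theta> C\<^sub>L\<^sub>S > 0 \<and>
            (\<forall>t s. 0 < t \<and> t < s \<longrightarrow>
              \<bar>\<alpha> t - \<alpha> s\<bar> \<le> C \<mu> \<gamma> \<alpha>0 (norm_H2 u0) \<theta> C\<^sub>L\<^sub>S
                * \<bar>energy \<sigma> (\<lambda>x. u x t, \<alpha> t) - energy \<sigma> (\<lambda>x. 0, \<alpha>bar)\<bar> powr \<theta> \<and>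
              norm_L2 (\<lambda>x. u x t - u x s) \<le> C \<mu> \<gamma> \<alpha>0 (norm_H2 u0) \<theta> C\<^sub>L\<^sub>S
                * \<bar>energy \<sigma> (\<lambda>x. u x t, \<alpha> t) - energy \<sigma> (\<lambda>x. 0, \<alpha>bar)\<bar> powr \<theta>)))"
\<comment> \<open>The witness is the constant \<open>K\<close> of
  \<open>lojasiewicz_estimate\<close>.\<close>
proof (rule exI[of _ "\<lambda>\<mu> \<gamma> _ _ \<theta> C. sqrt (\<gamma> + 2 * \<mu>) / (sqrt (min \<gamma> (\<mu> / 2)) * C * \<theta>)"],
    intro allI impI, elim conjE)
  fix \<mu> \<gamma> \<alpha>bar \<theta> C :: real and U
  assume pos: "\<mu> > 0" "\<gamma> > 0" "0 < \<theta>" "\<theta> \<le> 1/2" "C > 0"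
    and U: "nbhd_Y (\<lambda>x. 0, \<alpha>bar) U"
    and loj: "\<forall>(v, \<beta>)\<in>U. norm_Y (energy_gradient \<sigma> (v, \<beta>))
          \<ge> C * \<bar>energy \<sigma> (v, \<beta>) - energy \<sigma> (\<lambda>x. 0, \<alpha>bar)\<bar> powr (1 - \<theta>)"
  \<comment> \<open>Membership in \<open>U\<close> provides the Lojasiewicz-Simon inequality along
    the flow, and the unit ball provides the slope bound.\<close>
  define V where "V = {(v, \<beta>). (v, \<beta>) \<in> U \<and> norm_Y (v, \<beta> - \<alpha>bar) < 1}"
  let ?K = "sqrt (\<gamma> + 2 * \<mu>) / (sqrt (min \<gamma> (\<mu> / 2)) * C * \<theta>)"
  have V: "nbhd_Y (\<lambda>x. 0, \<alpha>bar) V"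
  proof -
    obtain e where e: "e > 0" "U \<subseteq> Y"
        "\<forall>(v, \<beta>)\<in>Y. norm_Y (\<lambda>x. v x - 0, \<beta> - \<alpha>bar) < e \<longrightarrow> (v, \<beta>) \<in> U"
      using U unfolding nbhd_Y_def prod.case by blast
    show ?thesis
      unfolding nbhd_Y_def prod.case
    proof (intro conjI exI[of _ "min e 1"])
      show "V \<subseteq> Y" using e(2) by (auto simp: V_def)
      show "\<forall>(v, \<beta>)\<in>Y. norm_Y (\<lambda>x. v x - 0, \<beta> - \<alpha>bar) < min e 1 \<longrightarrow> (v, \<beta>) \<in> V"
      proof (clarify)
        fix v \<beta> assume "(v, \<beta>) \<in> Y" and n: "norm_Y (\<lambda>x. v x - 0, \<beta> - \<alpha>bar) < min e 1"
        then have "(v, \<beta>) \<in> U" using e(3) by fastforce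
        then show "(v, \<beta>) \<in> V" using n by (simp add: V_def)
      qed
    qed (use e(1) in auto)
  qed
  have est: "?K > 0 \<and> (\<forall>t s. 0 < t \<and> t < s \<longrightarrow>
      \<bar>\<alpha> t - \<alpha> s\<bar> \<le> ?K * \<bar>energy \<sigma> (\<lambda>x. u x t, \<alpha> t) - energy \<sigma> (\<lambda>x. 0, \<alpha>bar)\<bar> powr \<theta> \<and>
      norm_L2 (\<lambda>x. u x t - u x s) \<le> ?K * \<bar>energy \<sigma> (\<lambda>x. u x t, \<alpha> t) - energy \<sigma> (\<lambda>x. 0, \<alpha>bar)\<bar> powr \<theta>)"
    if sol: "global_classical_solution \<sigma> \<mu> \<gamma> u0 \<alpha>0 u \<alpha>"
      and inV: "\<forall>t>0. (\<lambda>x. u x t, \<alpha> t) \<in> V" for u0 \<alpha>0 u \<alpha>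
  proof -
    have "\<sigma> x > 0" for x using assms(2,3) by (meson less_le_trans)
    then interpret graph_flow \<sigma> \<mu> \<gamma> u0 \<alpha>0 u \<alpha>
      by unfold_locales (use assms(1) pos sol in auto)
    have th: "\<theta> < 1" using pos by simp
    have "norm_Y (\<lambda>x. u x t, \<alpha> t - \<alpha>bar) < 1"
      "norm_Y (energy_gradient \<sigma> (\<lambda>x. u x t, \<alpha> t))
        \<ge> C * \<bar>energy \<sigma> (\<lambda>x. u x t, \<alpha> t) - energy \<sigma> (\<lambda>x. 0, \<alpha>bar)\<bar> powr (1 - \<theta>)" if "t > 0" for t
    proof -
      have tV: "(\<lambda>x. u x t, \<alpha> t) \<in> V" using inV that by blast
      then show "norm_Y (\<lambda>x. u x t, \<alpha> t - \<alpha>bar) < 1" by (simp add: V_def)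
      have "(\<lambda>x. u x t, \<alpha> t) \<in> U" using tV by (simp add: V_def)
      with loj show "norm_Y (energy_gradient \<sigma> (\<lambda>x. u x t, \<alpha> t))
        \<ge> C * \<bar>energy \<sigma> (\<lambda>x. u x t, \<alpha> t) - energy \<sigma> (\<lambda>x. 0, \<alpha>bar)\<bar> powr (1 - \<theta>)"
        by fast
    qed
    note est = lojasiewicz_estimate[OF pos(3) th pos(5) this]
    have "?K > 0" using pos by simp
    then show ?thesis using est by blast
  qed
  show "\<exists>V. nbhd_Y (\<lambda>x. 0, \<alpha>bar) V \<and>
        (\<forall>u0 \<alpha>0 u \<alpha>.
          (\<forall>x. u0 (x + 1) = u0 x) \<and> u0 \<in> H_per_ave 2 \<and>
          global_classical_solution \<sigma> \<mu> \<gamma> u0 \<alpha>0 u \<alpha> \<and>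
          (\<forall>t>0. (\<lambda>x. u x t, \<alpha> t) \<in> V)
          \<longrightarrow> ?K > 0 \<and>
            (\<forall>t s. 0 < t \<and> t < s \<longrightarrow>
              \<bar>\<alpha> t - \<alpha> s\<bar> \<le> ?K * \<bar>energy \<sigma> (\<lambda>x. u x t, \<alpha> t) - energy \<sigma> (\<lambda>x. 0, \<alpha>bar)\<bar> powr \<theta> \<and>
              norm_L2 (\<lambda>x. u x t - u x s) \<le> ?K * \<bar>energy \<sigma> (\<lambda>x. u x t, \<alpha> t) - energy \<sigma> (\<lambda>x. 0, \<alpha>bar)\<bar> powr \<theta>))"
  proof (intro exI[of _ V] conjI[OF V] allI impI, elim conjE)
    fix u0 :: "real \<Rightarrow> real" and \<alpha>0 u \<alpha>
    assume "global_classical_solution \<sigma> \<mu> \<gamma> u0 \<alpha>0 u \<alpha>" "\<forall>t>0. (\<lambda>x. u x t, \<alpha> t) \<in> V"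
    from est[OF this] show "?K > 0 \<and> (\<forall>t s. 0 < t \<and> t < s \<longrightarrow>
      \<bar>\<alpha> t - \<alpha> s\<bar> \<le> ?K * \<bar>energy \<sigma> (\<lambda>x. u x t, \<alpha> t) - energy \<sigma> (\<lambda>x. 0, \<alpha>bar)\<bar> powr \<theta> \<and>
      norm_L2 (\<lambda>x. u x t - u x s) \<le> ?K * \<bar>energy \<sigma> (\<lambda>x. u x t, \<alpha> t) - energy \<sigma> (\<lambda>x. 0, \<alpha>bar)\<bar> powr \<theta>)" .
  qed
qed

end
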